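(* Let $r\in C^\infty(J)$ be an admissible function and let $\Psi=(\Psi_0,\Psi_1,\dots,\Psi_{n+1})\colon M^k\to Q(r)\subset\mathbb{L}^{n+2}$ be a spacelike immersion. Then $\Psi$, as an immersion into $Q(r)$, is stationary if and only if $$\Delta\Psi=\alpha(\Psi_0)\Big[k-\big(r''(\Psi_0)r(\Psi_0)+r'(\Psi_0)^2-1\big)\|\nabla\Psi_0\|^2\Big]\,N,$$ where $\alpha(t)=\dfrac{-1}{r(t)\sqrt{1-r'(t)^2}}$ and $N$ is the unit normal vector field of $Q(r)$ evaluated along $\Psi$. Equivalently, $\Psi$ is stationary in $Q(r)$ if and only if $$\Delta\Psi+q_{\Psi_0}\,\mathbf{P}=0,$$ where $\mathbf{P}=\big(r(\Psi_0)r'(\Psi_0),\Psi_1,\dots,\Psi_{n+1}\big)$ and $$q_{\Psi_0}=\frac{k-\big(r''(\Psi_0)r(\Psi_0)+r'(\Psi_0)^2-1\big)\|\nabla\Psi_0\|^2}{r(\Psi_0)^2\big(1-r'(\Psi_0)^2\big)}\in C^\infty(M^k).$$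
   Context: $\mathbb{L}^{n+2}$ is $\mathbb{R}^{n+2}$ with coordinates $(t,x)=(t,x_1,\dots,x_{n+1})$ and the Lorentzian metric $\langle\,,\rangle=-dt^2+dx_1^2+\dots+dx_{n+1}^2$. Let $J\subset\mathbb{R}$ be an open interval with $0\in J$. A function $r\in C^\infty(J)$ is called admissible if $r(t)>0$ and $|r'(t)|<1$ for all $t\in J$. For such $r$, $Q(r)=\{(t,x)\in J\times\mathbb{R}^{n+1}: x_1^2+\dots+x_{n+1}^2=r(t)^2\}$, a hypersurface of $\mathbb{L}^{n+2}$ whose induced metric is Lorentzian. Its unit spacelike normal vector field is $N(t,x)=\frac{1}{r(t)\sqrt{1-r'(t)^2}}\big(r'(t)r(t),x\big)$. A spacelike immersion is an immersion of a $k$-dimensional manifold $M^k$ whose induced metric is Riemannian; $M^k$ is endowed with the induced metric. $\nabla$, $\Delta=\mathrm{div}\,\nabla$ and $\|\cdot\|$ are the gradient, Laplacian and norm of that metric, and $\Delta\Psi$ is computed componentwise regarding $\Psi$ as an $\mathbb{R}^{n+2}$-valued map. A spacelike immersion is stationary (in a given ambient Lorentzian manifold) if its mean curvature vector field (the normalized trace of its second fundamental form in that ambient manifold) vanishes identically. *)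

theory Defs
  imports "HOL-Analysis.Analysis"
begin

section \<open>Smooth maps and smooth manifolds\<close>

fun C_k_on :: "nat \<Rightarrow> 'a::euclidean_space set \<Rightarrow> ('a \<Rightarrow> 'b::real_normed_vector) \<Rightarrow> bool" where
  "C_k_on 0 S f \<longleftrightarrow> continuous_on S f"
| "C_k_on (Suc m) S f \<longleftrightarrow>
     (\<forall>x\<in>S. f differentiable (at x)) \<and>
     (\<forall>v. C_k_on m S (\<lambda>x. frechet_derivative f (at x) v))"

text \<open>Only meant for open \<open>S\<close>: the derivatives are full (not relative to \<open>S\<close>).\<close>

definition smooth_on :: "'a::euclidean_space set \<Rightarrow> ('a \<Rightarrow> 'b::real_normed_vector) \<Rightarrow> bool" where
  "smooth_on S f \<longleftrightarrow> (\<forall>m. C_k_on m S f)"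

text \<open>A chart is a pair \<open>(U, \<phi>)\<close>; the values of \<open>\<phi>\<close> outside \<open>U\<close> are irrelevant.  The dimension
  of the manifold is \<open>CARD('k)\<close>, hence at least 1.\<close>

type_synonym ('m, 'k) chart = "'m set \<times> ('m \<Rightarrow> real ^ 'k)"

definition chart_rep :: "('m, 'k::finite) chart \<Rightarrow> ('m \<Rightarrow> 'b) \<Rightarrow> real ^ 'k \<Rightarrow> 'b" where
  "chart_rep c f = f \<circ> inv_into (fst c) (snd c)"

definition smooth_manifold :: "'m topology \<Rightarrow> ('m, 'k::finite) chart set \<Rightarrow> bool" where
  "smooth_manifold T A \<longleftrightarrow>
     Hausdorff_space T \<and> second_countable T \<and>
     (\<Union>(U, \<phi>)\<in>A. U) = topspace T \<and>
     (\<forall>(U, \<phi>)\<in>A. openin T U \<and> open (\<phi> ` U) \<and>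
        homeomorphic_map (subtopology T U) (top_of_set (\<phi> ` U)) \<phi>) \<and>
     (\<forall>(U, \<phi>)\<in>A. \<forall>(V, \<psi>)\<in>A. smooth_on (\<phi> ` (U \<inter> V)) (chart_rep (U, \<phi>) \<psi>))"

definition smooth_map :: "('m, 'k::finite) chart set \<Rightarrow> ('m \<Rightarrow> 'b::real_normed_vector) \<Rightarrow> bool" where
  "smooth_map A f \<longleftrightarrow> (\<forall>(U, \<phi>)\<in>A. smooth_on (\<phi> ` U) (chart_rep (U, \<phi>) f))"

text \<open>Tensorial objects on a manifold are evaluated at \<open>p\<close> in some chart around \<open>p\<close>; the
  coordinate expressions below do not depend on which one.\<close>

definition chart_at :: "('m, 'k::finite) chart set \<Rightarrow> 'm \<Rightarrow> ('m, 'k) chart" where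
  "chart_at A p = (SOME c. c \<in> A \<and> p \<in> fst c)"


section \<open>Semi-Riemannian geometry in coordinates\<close>

text \<open>A metric on (an open part of) a vector space is a field of bilinear forms
  \<open>g x u v\<close>, with \<open>x\<close> the base point.\<close>

definition pullback_metric ::
  "('b::real_normed_vector \<Rightarrow> 'b \<Rightarrow> 'b \<Rightarrow> real) \<Rightarrow> ('a::euclidean_space \<Rightarrow> 'b) \<Rightarrow> 'a \<Rightarrow> 'a \<Rightarrow> 'a \<Rightarrow> real" where
  "pullback_metric g F y u v =
     g (F y) (frechet_derivative F (at y) u) (frechet_derivative F (at y) v)"

definition pd :: "'k \<Rightarrow> (real ^ 'k::finite \<Rightarrow> 'b::real_normed_vector) \<Rightarrow> real ^ 'k \<Rightarrow> 'b" where
  "pd i f y = frechet_derivative f (at y) (axis i 1)"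

type_synonym 'k coord_metric = "real ^ 'k \<Rightarrow> real ^ 'k \<Rightarrow> real ^ 'k \<Rightarrow> real"

definition gram :: "'k::finite coord_metric \<Rightarrow> real ^ 'k \<Rightarrow> real ^ 'k ^ 'k" where
  "gram g y = (\<chi> i j. g y (axis i 1) (axis j 1))"

definition ginv :: "'k::finite coord_metric \<Rightarrow> real ^ 'k \<Rightarrow> real ^ 'k ^ 'k" where
  "ginv g y = matrix_inv (gram g y)"

text \<open>\<open>christoffel g y i j l\<close> has the lower indices \<open>i\<close>, \<open>j\<close> and the upper index \<open>l\<close>.\<close>

definition christoffel :: "'k::finite coord_metric \<Rightarrow> real ^ 'k \<Rightarrow> 'k \<Rightarrow> 'k \<Rightarrow> 'k \<Rightarrow> real" where
  "christoffel g y i j l =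
     (1/2) * (\<Sum>m\<in>UNIV. ginv g y $ l $ m *
        (pd i (\<lambda>z. gram g z $ j $ m) y + pd j (\<lambda>z. gram g z $ i $ m) y
          - pd m (\<lambda>z. gram g z $ i $ j) y))"

definition grad :: "'k::finite coord_metric \<Rightarrow> (real ^ 'k \<Rightarrow> real) \<Rightarrow> real ^ 'k \<Rightarrow> real ^ 'k" where
  "grad g f y = (\<chi> i. \<Sum>j\<in>UNIV. ginv g y $ i $ j * pd j f y)"

text \<open>The divergence of \<open>W\<close> is the trace of its Levi-Civita covariant derivative.\<close>

definition divg :: "'k::finite coord_metric \<Rightarrow> (real ^ 'k \<Rightarrow> real ^ 'k) \<Rightarrow> real ^ 'k \<Rightarrow> real" where
  "divg g W y = (\<Sum>i\<in>UNIV. pd i (\<lambda>z. W z $ i) y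
                   + (\<Sum>j\<in>UNIV. christoffel g y i j i * W y $ j))"

text \<open>Let \<open>F\<close> be a map from coordinates of the submanifold to coordinates of the ambient space,
  which carries the metric \<open>h\<close>, and let \<open>W\<close> be the components of a vector field along \<open>F\<close>.
  \<open>cov_along h F W i\<close> is its covariant derivative in the \<open>i\<close>-th coordinate direction for the
  pull-back of the Levi-Civita connection of \<open>h\<close>.\<close>

definition cov_along :: "'d::finite coord_metric \<Rightarrow> (real ^ 'k::finite \<Rightarrow> real ^ 'd) \<Rightarrow>
    (real ^ 'k \<Rightarrow> real ^ 'd) \<Rightarrow> 'k \<Rightarrow> real ^ 'k \<Rightarrow> real ^ 'd" where
  "cov_along h F W i y =
     (\<chi> a. pd i W y $ a
        + (\<Sum>b\<in>UNIV. \<Sum>c\<in>UNIV. christoffel h (F y) b c a * pd i F y $ b * W y $ c))"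

definition normal_part :: "'d::finite coord_metric \<Rightarrow> (real ^ 'k::finite \<Rightarrow> real ^ 'd) \<Rightarrow>
    real ^ 'k \<Rightarrow> real ^ 'd \<Rightarrow> real ^ 'd" where
  "normal_part h F y u =
     u - (\<Sum>i\<in>UNIV. \<Sum>j\<in>UNIV.
            (ginv (pullback_metric h F) y $ i $ j * h (F y) u (pd i F y)) *\<^sub>R pd j F y)"

definition second_ff :: "'d::finite coord_metric \<Rightarrow> (real ^ 'k::finite \<Rightarrow> real ^ 'd) \<Rightarrow>
    'k \<Rightarrow> 'k \<Rightarrow> real ^ 'k \<Rightarrow> real ^ 'd" where
  "second_ff h F i j y = normal_part h F y (cov_along h F (pd j F) i y)"

definition mean_curv :: "'d::finite coord_metric \<Rightarrow> (real ^ 'k::finite \<Rightarrow> real ^ 'd) \<Rightarrow>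
    real ^ 'k \<Rightarrow> real ^ 'd" where
  "mean_curv h F y =
     (1 / real CARD('k)) *\<^sub>R
       (\<Sum>i\<in>UNIV. \<Sum>j\<in>UNIV. ginv (pullback_metric h F) y $ i $ j *\<^sub>R second_ff h F i j y)"


section \<open>Lorentz-Minkowski space and its hypersurfaces\<close>

text \<open>With \<open>CARD('d) = n + 1\<close> this is \<open>(n + 2)\<close>-dimensional Lorentz-Minkowski space, points being
  written \<open>(t, x)\<close>.  A hypersurface then has dimension \<open>CARD('d)\<close> and is parametrized by
  open subsets of \<open>real ^ 'd\<close>.\<close>

type_synonym 'd lspace = "real \<times> (real ^ 'd)"

definition lor :: "'d::finite lspace \<Rightarrow> 'd lspace \<Rightarrow> real" where
  "lor v w = - (fst v * fst w) + snd v \<bullet> snd w"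

abbreviation lor_metric :: "'d::finite lspace \<Rightarrow> 'd lspace \<Rightarrow> 'd lspace \<Rightarrow> real" where
  "lor_metric \<equiv> \<lambda>_. lor"

text \<open>Local parametrizations of an embedded hypersurface \<open>S\<close>: diffeomorphisms from an open set
  onto a relatively open part of \<open>S\<close>, where a map on a subset of a Euclidean space is smooth if
  it extends smoothly near every point.\<close>

definition parametrization :: "'d::finite lspace set \<Rightarrow> (real ^ 'd) set \<Rightarrow> (real ^ 'd \<Rightarrow> 'd lspace) \<Rightarrow> bool" where
  "parametrization S V X \<longleftrightarrow>
     open V \<and> smooth_on V X \<and> inj_on X V \<and> openin (top_of_set S) (X ` V) \<and>
     (\<forall>s\<in>X ` V. \<exists>W f. open W \<and> s \<in> W \<and> smooth_on W f \<and>
        (\<forall>z\<in>W \<inter> X ` V. f z = inv_into V X z))"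

definition param_at :: "'d::finite lspace set \<Rightarrow> 'd lspace \<Rightarrow> (real ^ 'd) set \<times> (real ^ 'd \<Rightarrow> 'd lspace)" where
  "param_at S s = (SOME (V, X). parametrization S V X \<and> s \<in> X ` V)"


section \<open>Spacelike immersions\<close>

text \<open>Smoothness of \<open>\<Psi>\<close> into the embedded hypersurface \<open>S\<close> is smoothness into the surrounding
  vector space, and the metric induced from \<open>S\<close> is the one induced from \<open>lor\<close>.\<close>

definition spacelike_immersion ::
  "'m topology \<Rightarrow> ('m, 'k::finite) chart set \<Rightarrow> 'd::finite lspace set \<Rightarrow> ('m \<Rightarrow> 'd lspace) \<Rightarrow> bool" where
  "spacelike_immersion T A S \<Psi> \<longleftrightarrow>
     \<Psi> ` topspace T \<subseteq> S \<and> smooth_map A \<Psi> \<and>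
     (\<forall>(U, \<phi>)\<in>A. \<forall>y\<in>\<phi> ` U.
        inj (frechet_derivative (chart_rep (U, \<phi>) \<Psi>) (at y)) \<and>
        (\<forall>u. u \<noteq> 0 \<longrightarrow> pullback_metric lor_metric (chart_rep (U, \<phi>) \<Psi>) y u u > 0))"

definition induced_metric :: "('m, 'k::finite) chart \<Rightarrow> ('m \<Rightarrow> 'd::finite lspace) \<Rightarrow> 'k coord_metric" where
  "induced_metric c \<Psi> = pullback_metric lor_metric (chart_rep c \<Psi>)"

definition grad_norm :: "('m, 'k::finite) chart set \<Rightarrow> ('m \<Rightarrow> 'd::finite lspace) \<Rightarrow> ('m \<Rightarrow> real) \<Rightarrow> 'm \<Rightarrow> real" where
  "grad_norm A \<Psi> f p =
     (let c = chart_at A p; g = induced_metric c \<Psi>; y = snd c p; v = grad g (chart_rep c f) y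
      in sqrt (g y v v))"

definition laplacian :: "('m, 'k::finite) chart set \<Rightarrow> ('m \<Rightarrow> 'd::finite lspace) \<Rightarrow> ('m \<Rightarrow> real) \<Rightarrow> 'm \<Rightarrow> real" where
  "laplacian A \<Psi> f p =
     (let c = chart_at A p; g = induced_metric c \<Psi>
      in divg g (grad g (chart_rep c f)) (snd c p))"

definition laplacian_vec :: "('m, 'k::finite) chart set \<Rightarrow> ('m \<Rightarrow> 'd::finite lspace) \<Rightarrow> ('m \<Rightarrow> 'd lspace) \<Rightarrow> 'm \<Rightarrow> 'd lspace" where
  "laplacian_vec A \<Psi> Z p =
     (laplacian A \<Psi> (\<lambda>x. fst (Z x)) p, \<chi> a. laplacian A \<Psi> (\<lambda>x. snd (Z x) $ a) p)"

text \<open>The mean curvature vector of \<open>\<Psi>\<close> as an immersion into \<open>S\<close>, computed intrinsically in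
  coordinates of \<open>S\<close> and then regarded as a vector of the surrounding vector space.\<close>

definition mean_curvature_vector :: "('m, 'k::finite) chart set \<Rightarrow> 'd::finite lspace set \<Rightarrow>
    ('m \<Rightarrow> 'd lspace) \<Rightarrow> 'm \<Rightarrow> 'd lspace" where
  "mean_curvature_vector A S \<Psi> p =
     (let c = chart_at A p; (V, X) = param_at S (\<Psi> p);
          F = inv_into V X \<circ> chart_rep c \<Psi>; y = snd c p
      in frechet_derivative X (at (F y)) (mean_curv (pullback_metric lor_metric X) F y))"

definition stationary_in :: "'m topology \<Rightarrow> ('m, 'k::finite) chart set \<Rightarrow> 'd::finite lspace set \<Rightarrow>
    ('m \<Rightarrow> 'd lspace) \<Rightarrow> bool" where
  "stationary_in T A S \<Psi> \<longleftrightarrow> (\<forall>p\<in>topspace T. mean_curvature_vector A S \<Psi> p = 0)"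


section \<open>The hypersurfaces \<open>Q(r)\<close>\<close>

definition admissible :: "real set \<Rightarrow> (real \<Rightarrow> real) \<Rightarrow> bool" where
  "admissible J r \<longleftrightarrow> smooth_on J r \<and> (\<forall>t\<in>J. r t > 0 \<and> \<bar>deriv r t\<bar> < 1)"

definition Q :: "real set \<Rightarrow> (real \<Rightarrow> real) \<Rightarrow> 'd::finite lspace set" where
  "Q J r = {(t, x). t \<in> J \<and> (\<Sum>i\<in>UNIV. (x $ i)^2) = (r t)^2}"

definition unit_normal :: "(real \<Rightarrow> real) \<Rightarrow> 'd::finite lspace \<Rightarrow> 'd lspace" where
  "unit_normal r = (\<lambda>(t, x). (1 / (r t * sqrt (1 - (deriv r t)^2))) *\<^sub>R (deriv r t * r t, x))"

definition alpha :: "(real \<Rightarrow> real) \<Rightarrow> real \<Rightarrow> real" where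
  "alpha r t = - 1 / (r t * sqrt (1 - (deriv r t)^2))"

definition P_field :: "(real \<Rightarrow> real) \<Rightarrow> ('m \<Rightarrow> 'd::finite lspace) \<Rightarrow> 'm \<Rightarrow> 'd lspace" where
  "P_field r \<Psi> p = (r (fst (\<Psi> p)) * deriv r (fst (\<Psi> p)), snd (\<Psi> p))"

definition bracket :: "(real \<Rightarrow> real) \<Rightarrow> ('m, 'k::finite) chart set \<Rightarrow> ('m \<Rightarrow> 'd::finite lspace) \<Rightarrow> 'm \<Rightarrow> real" where
  "bracket r A \<Psi> p =
     (let t = fst (\<Psi> p) in
      real CARD('k) - (deriv (deriv r) t * r t + (deriv r t)^2 - 1)
                        * (grad_norm A \<Psi> (\<lambda>x. fst (\<Psi> x)) p)^2)"

definition q_fun :: "(real \<Rightarrow> real) \<Rightarrow> ('m, 'k::finite) chart set \<Rightarrow> ('m \<Rightarrow> 'd::finite lspace) \<Rightarrow> 'm \<Rightarrow> real" where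
  "q_fun r A \<Psi> p =
     (let t = fst (\<Psi> p) in bracket r A \<Psi> p / ((r t)^2 * (1 - (deriv r t)^2)))"

end

theory Submission
  imports Defs
begin

text \<open>In a chart, with tangent vectors \<open>e\<^sub>i = \<partial>\<^sub>i\<Psi>\<close>, Gram matrix \<open>(g\<^sub>i\<^sub>j)\<close> and inverse \<open>(g\<^sup>i\<^sup>j)\<close>, differentiating
  \<open>\<Sum>\<^sub>i g\<^sub>m\<^sub>i W\<^sup>i = \<partial>\<^sub>m f\<close> for \<open>W = \<nabla>f\<close> shows that \<open>\<Delta>\<Psi>\<close> is the part normal to \<open>M\<close> of
  \<open>B = \<Sum>\<^sub>i\<^sub>j g\<^sup>i\<^sup>j \<partial>\<^sub>i\<partial>\<^sub>j\<Psi>\<close>.  The Levi-Civita connection of \<open>Q(r)\<close> is the projection to \<open>T Q(r)\<close> of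
  the flat one, so \<open>k\<close> times the mean curvature vector is \<open>\<Delta>\<Psi>\<close> minus its component along \<open>P\<close>,
  a vector field normal to \<open>Q(r)\<close>.  That component is computed by
  differentiating \<open>\<langle>e\<^sub>j, P\<rangle> = 0\<close> and taking the trace with \<open>g\<^sup>i\<^sup>j\<close>; this gives \<open>- q P\<close>.\<close>

section \<open>Calculus of \<open>C\<^sup>m\<close> maps on open sets\<close>

text \<open>The field P is half the Lorentz gradient of |x|^2 - r(t)^2, hence normal to
  \<open>Q\<close>, and <P, P> = r^2 (1 - r'^2) is the denominator of q. In the bracket, k is the
  trace of the metric against its own inverse, while r'' r + r'^2 - 1 is (r r')' minus the 1 that
  arises when the Euclidean product of the spatial parts of two tangent vectors is rewritten as
  their Lorentz product plus the product of their time components. The obstacle is that the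
  definitions contain arbitrary choices: a chart by \<open>chart_at\<close> and a parametrization by
  \<open>param_at\<close>. The parametrization drops out because the projection onto the hyperplane
  tangent to \<open>Q\<close> can be written with P alone. The Laplacian and the mean curvature at a
  point use the same chart, so comparing them calls for no change of charts. Smoothness of q does,
  since the chosen chart may vary erratically with the point. There the squared gradient norm of the
  time coordinate is read as the Lorentz square of the projection of one fixed vector onto the
  tangent space of M, and this depends only on the span of the frame.\<close>

lemma frechet_derivative_cong_open:
  assumes "open S" "x \<in> S" "\<And>y. y \<in> S \<Longrightarrow> f y = g y"
  shows "frechet_derivative f (at x) = frechet_derivative g (at x)"
proof -
  \<comment> \<open>\<open>frechet_derivative\<close> is a Hilbert choice, so the two derivatives
    agree once \<open>f\<close> and \<open>g\<close> satisfy \<open>has_derivative\<close> for the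
    same linear maps. This also covers points where neither is differentiable.\<close>
  have "(f has_derivative f') (at x) \<longleftrightarrow> (g has_derivative f') (at x)" for f'
    using has_derivative_transform_within_open[of f f' x UNIV S g]
      has_derivative_transform_within_open[of g f' x UNIV S f] assms by auto
  then show ?thesis
    unfolding frechet_derivative_def by simp
qed

lemma differentiable_cong_open:
  assumes "open S" "x \<in> S" "\<And>y. y \<in> S \<Longrightarrow> f y = g y"
  shows "f differentiable (at x) \<longleftrightarrow> g differentiable (at x)"
  using has_derivative_transform_within_open[of f _ x UNIV S g]
      has_derivative_transform_within_open[of g _ x UNIV S f] assms
  unfolding differentiable_def by metis

lemma C_k_on_cong:
  assumes "open S" "\<And>y. y \<in> S \<Longrightarrow> f y = g y"
  shows "C_k_on m S f \<longleftrightarrow> C_k_on m S g"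
  using assms(2)
proof (induction m arbitrary: f g)
  case 0
  then show ?case using continuous_on_cong by auto
next
  case (Suc m)
  have "C_k_on m S (\<lambda>x. frechet_derivative f (at x) v) \<longleftrightarrow>
        C_k_on m S (\<lambda>x. frechet_derivative g (at x) v)" for v
    by (rule Suc.IH) (use frechet_derivative_cong_open[OF assms(1)] Suc.prems in metis)
  then show ?case
    using differentiable_cong_open[OF assms(1)] Suc.prems by (metis C_k_on.simps(2))
qed

lemma C_k_on_subset: "C_k_on m S f \<Longrightarrow> S' \<subseteq> S \<Longrightarrow> C_k_on m S' f"
  by (induction m arbitrary: f) (auto intro: continuous_on_subset)

lemma C_k_on_imp_continuous_on: "C_k_on m S f \<Longrightarrow> continuous_on S f"
  by (cases m)
    (auto intro!: continuous_at_imp_continuous_on differentiable_imp_continuous_within)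

lemma C_k_on_SucD: "C_k_on (Suc m) S f \<Longrightarrow> C_k_on m S f"
proof (induction m arbitrary: f)
  case 0
  then show ?case by (metis C_k_on.simps(1) C_k_on_imp_continuous_on)
next
  case (Suc m)
  then show ?case by (metis C_k_on.simps(2))
qed

lemma C_k_on_const: "C_k_on m S (\<lambda>x. c)"
  by (induction m arbitrary: c) auto

text \<open>Lets the inductions below work with an explicit formula for the derivative in place of
  the chosen \<open>frechet_derivative\<close>.\<close>

lemma C_k_on_SucI:
  assumes "open S" "\<And>x. x \<in> S \<Longrightarrow> (f has_derivative f' x) (at x)"
    "\<And>v. C_k_on m S (\<lambda>x. f' x v)"
  shows "C_k_on (Suc m) S f"
proof -
  have "frechet_derivative f (at x) = f' x" if "x \<in> S" for x
    using assms(2)[OF that] frechet_derivative_at by metis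
  then have "C_k_on m S (\<lambda>x. frechet_derivative f (at x) v)" for v
    by (subst C_k_on_cong[OF assms(1), of _ "\<lambda>x. f' x v"]) (simp_all add: assms(3))
  then show ?thesis
    using assms(2) by (auto simp: differentiable_def)
qed

lemma has_derivative_frechet:
  "f differentiable (at x) \<Longrightarrow> (f has_derivative frechet_derivative f (at x)) (at x)"
  by (simp add: frechet_derivative_works)

lemma C_k_on_has_derivative:
  "C_k_on (Suc m) S f \<Longrightarrow> x \<in> S \<Longrightarrow> (f has_derivative frechet_derivative f (at x)) (at x)"
  by (simp add: has_derivative_frechet)

lemma C_k_on_bounded_linear_comp:
  assumes "open S" "bounded_linear L" "C_k_on m S f"
  shows "C_k_on m S (\<lambda>x. L (f x))"
  using assms(3)
proof (induction m arbitrary: f)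
  case 0
  then show ?case
    using bounded_linear.continuous_on[OF assms(2)] by auto
next
  case (Suc m)
  show ?case
  proof (rule C_k_on_SucI[OF assms(1)])
    show "((\<lambda>x. L (f x)) has_derivative (\<lambda>v. L (frechet_derivative f (at x) v))) (at x)" if "x \<in> S" for x
      using bounded_linear.has_derivative[OF assms(2) C_k_on_has_derivative[OF Suc.prems that]] .
    show "C_k_on m S (\<lambda>x. L (frechet_derivative f (at x) v))" for v
      using Suc by simp
  qed
qed

lemma C_k_on_add:
  assumes "open S" "C_k_on m S f" "C_k_on m S g"
  shows "C_k_on m S (\<lambda>x. f x + g x)"
  using assms(2,3)
proof (induction m arbitrary: f g)
  case 0
  then show ?case by (auto intro: continuous_on_add)
next
  case (Suc m)
  show ?case
  proof (rule C_k_on_SucI[OF assms(1)])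
    show "((\<lambda>x. f x + g x) has_derivative
        (\<lambda>v. frechet_derivative f (at x) v + frechet_derivative g (at x) v)) (at x)" if "x \<in> S" for x
      using C_k_on_has_derivative[OF Suc.prems(1) that] C_k_on_has_derivative[OF Suc.prems(2) that]
      by (rule has_derivative_add)
    show "C_k_on m S (\<lambda>x. frechet_derivative f (at x) v + frechet_derivative g (at x) v)" for v
      using Suc by simp
  qed
qed

text \<open>By the Leibniz rule each derivative is a sum of two expressions of the same shape, so
  the induction closes. Products, scalar multiples and \<open>lor\<close> are all instances.\<close>

lemma C_k_on_bounded_bilinear:
  assumes "open S" "bounded_bilinear B" "C_k_on m S f" "C_k_on m S g"
  shows "C_k_on m S (\<lambda>x. B (f x) (g x))"
  using assms(3,4)
proof (induction m arbitrary: f g)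
  case 0
  then show ?case
    using bounded_bilinear.continuous_on[OF assms(2)] by auto
next
  case (Suc m)
  show ?case
  proof (rule C_k_on_SucI[OF assms(1)])
    show "((\<lambda>x. B (f x) (g x)) has_derivative
        (\<lambda>v. B (f x) (frechet_derivative g (at x) v) + B (frechet_derivative f (at x) v) (g x))) (at x)"
      if "x \<in> S" for x
      by (rule bounded_bilinear.FDERIV[OF assms(2) C_k_on_has_derivative[OF Suc.prems(1) that]
            C_k_on_has_derivative[OF Suc.prems(2) that]])
    show "C_k_on m S (\<lambda>x. B (f x) (frechet_derivative g (at x) v) + B (frechet_derivative f (at x) v) (g x))" for v
      using Suc.prems C_k_on_SucD[OF Suc.prems(1)] C_k_on_SucD[OF Suc.prems(2)]
      by (intro C_k_on_add[OF assms(1)] Suc.IH) simp_all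
  qed
qed

lemma C_k_on_sum:
  assumes "open S" "\<And>i. i \<in> I \<Longrightarrow> C_k_on m S (f i)"
  shows "C_k_on m S (\<lambda>x. \<Sum>i\<in>I. f i x)"
  using assms(2)
proof (induction I rule: infinite_finite_induct)
  case (insert i I)
  then show ?case by (simp add: C_k_on_add[OF assms(1)])
qed (simp_all add: C_k_on_const)

lemma C_k_on_compose:
  fixes f :: "'b::euclidean_space \<Rightarrow> 'c::real_normed_vector" and g :: "'a::euclidean_space \<Rightarrow> 'b"
  assumes "open S" "C_k_on m S g" "C_k_on m U f" "g ` S \<subseteq> U"
  shows "C_k_on m S (\<lambda>x. f (g x))"
  using assms(2,3)
proof (induction m arbitrary: f)
  case 0
  then show ?case using continuous_on_compose2 assms(4) by auto
next
  case (Suc m)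
  let ?f' = "\<lambda>y. frechet_derivative f (at y)" and ?g' = "\<lambda>x. frechet_derivative g (at x)"
  note f' = C_k_on_has_derivative[OF Suc.prems(2)]
  have gU: "g x \<in> U" if "x \<in> S" for x
    using assms(4) that by auto
  \<comment> \<open>In the chain rule the direction \<open>?g' x v\<close> varies with
    \<open>x\<close>, whereas \<open>C_k_on\<close> speaks of derivatives in fixed directions.
    Expanding it in the basis leaves fixed directions \<open>b\<close> with variable scalar
    coefficients.\<close>
  have expand: "?f' (g x) (?g' x v) = (\<Sum>b\<in>Basis. (?g' x v \<bullet> b) *\<^sub>R ?f' (g x) b)" if "x \<in> S" for x v
  proof -
    interpret linear "?f' (g x)"
      using f'[OF gU[OF that]] by (rule has_derivative_linear)
    have "?f' (g x) (?g' x v) = ?f' (g x) (\<Sum>b\<in>Basis. (?g' x v \<bullet> b) *\<^sub>R b)"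
      by (simp add: euclidean_representation)
    then show ?thesis by (simp only: sum scale)
  qed
  show ?case
  proof (rule C_k_on_SucI[OF assms(1)])
    show "((\<lambda>x. f (g x)) has_derivative (\<lambda>v. ?f' (g x) (?g' x v))) (at x)" if "x \<in> S" for x
      using has_derivative_compose[OF C_k_on_has_derivative[OF Suc.prems(1) that] f'[OF gU[OF that]]] .
    show "C_k_on m S (\<lambda>x. ?f' (g x) (?g' x v))" for v
    proof -
      have "C_k_on m S (\<lambda>x. \<Sum>b\<in>Basis. (?g' x v \<bullet> b) *\<^sub>R ?f' (g x) b)"
      proof (intro C_k_on_sum[OF assms(1)] C_k_on_bounded_bilinear[OF assms(1) bounded_bilinear_scaleR])
        fix b :: 'b
        show "C_k_on m S (\<lambda>x. ?g' x v \<bullet> b)"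
          by (rule C_k_on_bounded_linear_comp[OF assms(1) bounded_linear_inner_left])
            (use Suc.prems(1) in simp)
        show "C_k_on m S (\<lambda>x. ?f' (g x) b)"
          using Suc.prems C_k_on_SucD[OF Suc.prems(1)] by (intro Suc.IH) simp_all
      qed
      then show ?thesis
        by (subst C_k_on_cong[OF assms(1) expand])
    qed
  qed
qed

lemma C_k_on_bounded_linear:
  assumes "open S" "bounded_linear L"
  shows "C_k_on m S L"
proof (cases m)
  case 0
  then show ?thesis
    using assms linear_continuous_on by auto
next
  case (Suc n)
  have "C_k_on (Suc n) S L"
    by (rule C_k_on_SucI[OF assms(1), of _ "\<lambda>_. L"])
      (auto simp: bounded_linear_imp_has_derivative assms C_k_on_const)
  with Suc show ?thesis by simp
qed

text \<open>The derivative is a polynomial in \<open>inverse\<close> itself, so the induction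
  hypothesis applies to it. For \<open>sqrt\<close> below, the derivative is likewise built from
  \<open>sqrt\<close> and \<open>inverse\<close>.\<close>

lemma C_k_on_inverse: "C_k_on m {0<..} (inverse :: real \<Rightarrow> real)"
proof (induction m)
  case 0
  show ?case by (auto intro!: continuous_intros)
next
  case (Suc m)
  show ?case
  proof (rule C_k_on_SucI)
    show "(inverse has_derivative (\<lambda>v. - v * (inverse x * inverse x))) (at x)" if "x \<in> {0<..}" for x :: real
      using that by (auto intro!: derivative_eq_intros simp: field_simps)
    show "C_k_on m {0<..} (\<lambda>x::real. - v * (inverse x * inverse x))" for v
      by (intro C_k_on_bounded_bilinear[OF _ bounded_bilinear_mult] C_k_on_const Suc) auto
  qed simp
qed

lemma C_k_on_sqrt: "C_k_on m {0<..} sqrt"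
proof (induction m)
  case 0
  show ?case by (auto intro!: continuous_intros)
next
  case (Suc m)
  show ?case
  proof (rule C_k_on_SucI)
    show "(sqrt has_derivative (\<lambda>v. (v / 2) * inverse (sqrt x))) (at x)" if "x \<in> {0<..}" for x :: real
      using that by (auto intro!: derivative_eq_intros simp: field_simps)
    show "C_k_on m {0<..} (\<lambda>x::real. (v / 2) * inverse (sqrt x))" for v
      by (intro C_k_on_bounded_bilinear[OF _ bounded_bilinear_mult] C_k_on_const
          C_k_on_compose[OF _ Suc C_k_on_inverse]) auto
  qed simp
qed

section \<open>Closure properties of smooth maps\<close>

lemma smooth_on_cong:
  assumes "open S" "\<And>y. y \<in> S \<Longrightarrow> f y = g y"
  shows "smooth_on S f \<longleftrightarrow> smooth_on S g"
  unfolding smooth_on_def using C_k_on_cong[OF assms] by simp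

lemma smooth_on_subset: "smooth_on S f \<Longrightarrow> S' \<subseteq> S \<Longrightarrow> smooth_on S' f"
  unfolding smooth_on_def using C_k_on_subset by blast

lemma smooth_on_imp_continuous_on: "smooth_on S f \<Longrightarrow> continuous_on S f"
  unfolding smooth_on_def using C_k_on_imp_continuous_on by blast

lemma smooth_on_has_derivative:
  "smooth_on S f \<Longrightarrow> x \<in> S \<Longrightarrow> (f has_derivative frechet_derivative f (at x)) (at x)"
  unfolding smooth_on_def using C_k_on_has_derivative by blast

lemma smooth_on_differentiable: "smooth_on S f \<Longrightarrow> x \<in> S \<Longrightarrow> f differentiable (at x)"
  using smooth_on_has_derivative differentiable_def by blast

lemma smooth_on_frechet_derivative:
  "smooth_on S f \<Longrightarrow> smooth_on S (\<lambda>x. frechet_derivative f (at x) v)"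
  unfolding smooth_on_def using C_k_on.simps(2) by blast

lemma smooth_on_const: "smooth_on S (\<lambda>x. c)"
  unfolding smooth_on_def using C_k_on_const by blast

lemma smooth_on_bounded_linear: "open S \<Longrightarrow> bounded_linear L \<Longrightarrow> smooth_on S L"
  unfolding smooth_on_def using C_k_on_bounded_linear by blast

lemma smooth_on_bounded_linear_comp:
  "open S \<Longrightarrow> bounded_linear L \<Longrightarrow> smooth_on S f \<Longrightarrow> smooth_on S (\<lambda>x. L (f x))"
  unfolding smooth_on_def using C_k_on_bounded_linear_comp by blast

lemma smooth_on_add:
  "open S \<Longrightarrow> smooth_on S f \<Longrightarrow> smooth_on S g \<Longrightarrow> smooth_on S (\<lambda>x. f x + g x)"
  unfolding smooth_on_def using C_k_on_add by blast

lemma smooth_on_bounded_bilinear: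
  "open S \<Longrightarrow> bounded_bilinear B \<Longrightarrow> smooth_on S f \<Longrightarrow> smooth_on S g \<Longrightarrow> smooth_on S (\<lambda>x. B (f x) (g x))"
  unfolding smooth_on_def using C_k_on_bounded_bilinear by blast

lemmas smooth_on_mult = smooth_on_bounded_bilinear[OF _ bounded_bilinear_mult]
lemmas smooth_on_scaleR = smooth_on_bounded_bilinear[OF _ bounded_bilinear_scaleR]

lemma smooth_on_diff:
  assumes "open S" "smooth_on S f" "smooth_on S g"
  shows "smooth_on S (\<lambda>x. f x - g x)"
  using smooth_on_add[OF assms(1,2) smooth_on_bounded_linear_comp[OF assms(1) bounded_linear_minus[OF bounded_linear_ident] assms(3)]]
  by simp

lemma smooth_on_sum:
  "open S \<Longrightarrow> (\<And>i. i \<in> I \<Longrightarrow> smooth_on S (f i)) \<Longrightarrow> smooth_on S (\<lambda>x. \<Sum>i\<in>I. f i x)"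
  unfolding smooth_on_def using C_k_on_sum[of S I _ f] by simp

lemma smooth_on_prod:
  fixes f :: "'i \<Rightarrow> 'a::euclidean_space \<Rightarrow> real"
  assumes "open S" "\<And>i. i \<in> I \<Longrightarrow> smooth_on S (f i)"
  shows "smooth_on S (\<lambda>x. \<Prod>i\<in>I. f i x)"
  using assms(2)
proof (induction I rule: infinite_finite_induct)
  case (insert i I)
  then show ?case by (simp add: smooth_on_mult[OF assms(1)])
qed (simp_all add: smooth_on_const)

lemma smooth_on_power2:
  fixes f :: "'a::euclidean_space \<Rightarrow> real"
  shows "open S \<Longrightarrow> smooth_on S f \<Longrightarrow> smooth_on S (\<lambda>x. (f x)\<^sup>2)"
  unfolding power2_eq_square by (rule smooth_on_mult)

lemma smooth_on_compose:
  fixes f :: "'b::euclidean_space \<Rightarrow> 'c::real_normed_vector" and g :: "'a::euclidean_space \<Rightarrow> 'b"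
  shows "open S \<Longrightarrow> smooth_on S g \<Longrightarrow> smooth_on U f \<Longrightarrow> g ` S \<subseteq> U \<Longrightarrow> smooth_on S (\<lambda>x. f (g x))"
  unfolding smooth_on_def using C_k_on_compose by blast

lemma smooth_on_sqrt:
  "open S \<Longrightarrow> smooth_on S f \<Longrightarrow> (\<And>x. x \<in> S \<Longrightarrow> f x > 0) \<Longrightarrow> smooth_on S (\<lambda>x. sqrt (f x))"
  using smooth_on_compose[of S f "{0<..}" sqrt] C_k_on_sqrt unfolding smooth_on_def by auto

lemma smooth_on_inverse_pos:
  fixes f :: "'a::euclidean_space \<Rightarrow> real"
  shows "open S \<Longrightarrow> smooth_on S f \<Longrightarrow> (\<And>x. x \<in> S \<Longrightarrow> f x > 0) \<Longrightarrow> smooth_on S (\<lambda>x. inverse (f x))"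
  using smooth_on_compose[of S f "{0<..}" inverse] C_k_on_inverse unfolding smooth_on_def by auto

lemma smooth_on_divide:
  fixes f :: "'a::euclidean_space \<Rightarrow> real"
  assumes "open S" "smooth_on S f" "smooth_on S g" "\<And>x. x \<in> S \<Longrightarrow> g x \<noteq> 0"
  shows "smooth_on S (\<lambda>x. f x / g x)"
proof -
  \<comment> \<open>The denominator may have either sign. Writing f / g as f g / g^2 reduces to the
    inverse of a positive function.\<close>
  have "smooth_on S (\<lambda>x. (f x * g x) * inverse ((g x)\<^sup>2))"
    by (intro smooth_on_mult smooth_on_inverse_pos smooth_on_power2 assms) (use assms(4) in auto)
  moreover have "f x / g x = (f x * g x) * inverse ((g x)\<^sup>2)" if "x \<in> S" for x
    using assms(4)[OF that] by (simp add: power2_eq_square field_simps)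
  ultimately show ?thesis
    using smooth_on_cong[OF assms(1), of "\<lambda>x. f x / g x" "\<lambda>x. (f x * g x) * inverse ((g x)\<^sup>2)"]
    by blast
qed

lemma smooth_on_vec_lambda:
  fixes f :: "'a::euclidean_space \<Rightarrow> 'i::finite \<Rightarrow> real"
  assumes "open S" "\<And>i. smooth_on S (\<lambda>x. f x i)"
  shows "smooth_on S (\<lambda>x. \<chi> i. f x i)"
proof -
  have eq: "(\<chi> i. f x i) = (\<Sum>i\<in>UNIV. f x i *\<^sub>R axis i 1)" for x
    by (simp add: vec_eq_iff axis_def if_distrib cong: if_cong)
  show ?thesis
    unfolding eq by (intro smooth_on_sum smooth_on_scaleR smooth_on_const assms)
qed

lemma smooth_on_Pair:
  assumes "open S" "smooth_on S f" "smooth_on S g"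
  shows "smooth_on S (\<lambda>x. (f x, g x))"
proof -
  have "smooth_on S (\<lambda>x. (f x, 0) + (0, g x))"
    by (rule smooth_on_add[OF assms(1)]; rule smooth_on_bounded_linear_comp[OF assms(1)];
        (rule assms)?; intro bounded_linear_Pair bounded_linear_ident bounded_linear_zero)
  then show ?thesis by simp
qed

lemma smooth_on_has_real_derivative:
  fixes r :: "real \<Rightarrow> real"
  shows "smooth_on S r \<Longrightarrow> t \<in> S \<Longrightarrow> (r has_real_derivative deriv r t) (at t)"
  by (simp add: DERIV_deriv_iff_real_differentiable smooth_on_differentiable)

lemma smooth_on_deriv:
  assumes "open S" "smooth_on S r"
  shows "smooth_on S (deriv r :: real \<Rightarrow> real)"
proof -
  have "deriv r t = frechet_derivative r (at t) 1" if "t \<in> S" for t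
    using frechet_derivative_at[OF has_field_derivative_imp_has_derivative[OF
        smooth_on_has_real_derivative[OF assms(2) that]]] by (metis mult.right_neutral)
  then show ?thesis
    by (subst smooth_on_cong[OF assms(1), of _ "\<lambda>t. frechet_derivative r (at t) 1"])
      (simp_all add: smooth_on_frechet_derivative[OF assms(2)])
qed

section \<open>Symmetry of second derivatives\<close>

text \<open>The mean value theorem is applied twice: to the increment \<open>A\<close> in direction
  \<open>v\<close>, as a function of the parameter along \<open>u\<close>, and then to the
  \<open>u\<close>-derivative along \<open>v\<close>.\<close>

lemma second_difference_mean_value:
  fixes f :: "'a::euclidean_space \<Rightarrow> real"
  assumes f: "C_k_on (Suc (Suc 0)) S f" and h: "h > 0"
    and S: "\<And>s t. 0 \<le> s \<Longrightarrow> s \<le> h \<Longrightarrow> 0 \<le> t \<Longrightarrow> t \<le> h \<Longrightarrow> y + s *\<^sub>R u + t *\<^sub>R v \<in> S"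
  obtains s t where "0 < s" "s < h" "0 < t" "t < h"
    "f (y + h *\<^sub>R u + h *\<^sub>R v) - f (y + h *\<^sub>R u) - f (y + h *\<^sub>R v) + f y =
      h * h * frechet_derivative (\<lambda>x. frechet_derivative f (at x) u) (at (y + s *\<^sub>R u + t *\<^sub>R v)) v"
proof -
  let ?D = "\<lambda>x. frechet_derivative f (at x)"
  let ?D2 = "\<lambda>x. frechet_derivative (\<lambda>x. ?D x u) (at x)"
  have D: "(f has_derivative ?D x) (at x)" if "x \<in> S" for x
    using C_k_on_has_derivative[OF f that] .
  have D2: "((\<lambda>x. ?D x u) has_derivative ?D2 x) (at x)" if "x \<in> S" for x
    using f that by (simp add: frechet_derivative_works)
  have line: "((\<lambda>s. g (x + s *\<^sub>R w)) has_real_derivative g' w) (at s)"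
    if "(g has_derivative g') (at (x + s *\<^sub>R w))" for g :: "'a \<Rightarrow> real" and g' x w s
  proof -
    have "((\<lambda>s. g (x + s *\<^sub>R w)) has_derivative (\<lambda>t. g' (t *\<^sub>R w))) (at s)"
      by (rule has_derivative_compose[of "\<lambda>s. x + s *\<^sub>R w", OF _ that]) (auto intro!: derivative_eq_intros)
    moreover have "(\<lambda>t. g' (t *\<^sub>R w)) = (*) (g' w)"
      using linear_scale[OF has_derivative_linear[OF that]] by auto
    ultimately show ?thesis
      by (simp add: has_field_derivative_def)
  qed
  define A where "A s = f (y + h *\<^sub>R v + s *\<^sub>R u) - f (y + s *\<^sub>R u)" for s
  have A: "(A has_real_derivative (?D (y + h *\<^sub>R v + s *\<^sub>R u) u - ?D (y + s *\<^sub>R u) u)) (at s)"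
    if "0 \<le> s" "s \<le> h" for s
    unfolding A_def using S[of s h] S[of s 0] that h
    by (intro DERIV_diff line D) (auto simp: add_ac)
  obtain s where s: "0 < s" "s < h"
    "A h - A 0 = (h - 0) * (?D (y + h *\<^sub>R v + s *\<^sub>R u) u - ?D (y + s *\<^sub>R u) u)"
    using MVT2[OF h A] by blast
  have B: "((\<lambda>t. ?D ((y + s *\<^sub>R u) + t *\<^sub>R v) u) has_real_derivative
      ?D2 ((y + s *\<^sub>R u) + t *\<^sub>R v) v) (at t)" if "0 \<le> t" "t \<le> h" for t
    by (rule line[OF D2]) (use S[of s t] s that in auto)
  obtain t where t: "0 < t" "t < h"
    "?D ((y + s *\<^sub>R u) + h *\<^sub>R v) u - ?D ((y + s *\<^sub>R u) + 0 *\<^sub>R v) u =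
      (h - 0) * ?D2 ((y + s *\<^sub>R u) + t *\<^sub>R v) v"
    using MVT2[OF h B] by blast
  have "A h - A 0 = h * h * ?D2 (y + s *\<^sub>R u + t *\<^sub>R v) v"
    using s(3) t(3) by (simp add: add_ac mult_ac)
  then show ?thesis
    by (intro that[OF s(1,2) t(1,2)]) (simp add: A_def add_ac algebra_simps)
qed

text \<open>The second difference does not change when \<open>u\<close> and \<open>v\<close> are
  exchanged, so the two mixed derivatives take a common value at points arbitrarily close to
  \<open>y\<close>. Continuity of both then forces equality at \<open>y\<close>.\<close>

lemma second_derivative_symmetric_real:
  fixes f :: "'a::euclidean_space \<Rightarrow> real"
  assumes S: "open S" "y \<in> S" and f: "C_k_on (Suc (Suc 0)) S f"
  shows "frechet_derivative (\<lambda>x. frechet_derivative f (at x) u) (at y) v =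
         frechet_derivative (\<lambda>x. frechet_derivative f (at x) v) (at y) u"
proof (rule ccontr)
  define K where "K u v x = frechet_derivative (\<lambda>x. frechet_derivative f (at x) u) (at x) v" for u v x
  assume "\<not> ?thesis"
  then have neq: "K u v y \<noteq> K v u y"
    by (simp add: K_def)
  have cont: "isCont (K u v) y" for u v
    using f S unfolding K_def by (simp add: continuous_on_eq_continuous_at)
  \<comment> \<open>Half the gap: a number within \<open>e\<close> of both values would contradict
    the triangle inequality.\<close>
  define e where "e = dist (K u v y) (K v u y) / 2"
  have e: "e > 0"
    using neq by (simp add: e_def)
  obtain d1 where d1: "d1 > 0" "\<And>x. dist x y < d1 \<Longrightarrow> dist (K u v x) (K u v y) < e"
    using cont[of u v] e unfolding continuous_at_eps_delta by metis
  obtain d2 where d2: "d2 > 0" "\<And>x. dist x y < d2 \<Longrightarrow> dist (K v u x) (K v u y) < e"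
    using cont[of v u] e unfolding continuous_at_eps_delta by metis
  obtain d3 where d3: "d3 > 0" "ball y d3 \<subseteq> S"
    using S openE by blast
  define d where "d = min d1 (min d2 d3)"
  have d: "d > 0" "d \<le> d1" "d \<le> d2" "d \<le> d3"
    using d1(1) d2(1) d3(1) by (auto simp: d_def)
  \<comment> \<open>With this side length the parallelogram spanned at \<open>y\<close> stays within
    distance \<open>d\<close>. The summand 1 keeps the denominator positive when \<open>u\<close>
    and \<open>v\<close> vanish.\<close>
  define h where "h = d / (norm u + norm v + 1)"
  have h: "h > 0"
    unfolding h_def using d(1) by (intro divide_pos_pos) (auto simp: add_nonneg_pos)
  have near: "dist (y + s *\<^sub>R a + t *\<^sub>R b) y < d"
    if "0 \<le> s" "s \<le> h" "0 \<le> t" "t \<le> h" and ab: "norm a + norm b = norm u + norm v" for s t a b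
  proof -
    have "dist (y + s *\<^sub>R a + t *\<^sub>R b) y \<le> norm (s *\<^sub>R a) + norm (t *\<^sub>R b)"
      using norm_triangle_ineq[of "s *\<^sub>R a" "t *\<^sub>R b"] by (simp add: dist_norm add.assoc)
    also have "\<dots> \<le> h * norm a + h * norm b"
      using that by (intro add_mono) (auto intro: mult_right_mono)
    also have "\<dots> = h * (norm u + norm v)"
      by (simp add: ab[symmetric] distrib_left)
    also have "\<dots> < h * (norm u + norm v + 1)"
      using h by simp
    also have "\<dots> = d"
      unfolding h_def using norm_ge_zero[of u] norm_ge_zero[of v] by (simp add: add_nonneg_eq_0_iff)
    finally show ?thesis .
  qed
  have inS: "y + s *\<^sub>R a + t *\<^sub>R b \<in> S"
    if "0 \<le> s" "s \<le> h" "0 \<le> t" "t \<le> h" "norm a + norm b = norm u + norm v" for s t a b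
    using near[OF that] d(4) d3(2) by (auto simp: dist_commute subset_iff)
  obtain s t where st: "0 < s" "s < h" "0 < t" "t < h"
    "f (y + h *\<^sub>R u + h *\<^sub>R v) - f (y + h *\<^sub>R u) - f (y + h *\<^sub>R v) + f y =
      h * h * K u v (y + s *\<^sub>R u + t *\<^sub>R v)"
    unfolding K_def by (rule second_difference_mean_value[OF f h, of y u v]) (auto intro: inS)
  obtain s' t' where st': "0 < s'" "s' < h" "0 < t'" "t' < h"
    "f (y + h *\<^sub>R v + h *\<^sub>R u) - f (y + h *\<^sub>R v) - f (y + h *\<^sub>R u) + f y =
      h * h * K v u (y + s' *\<^sub>R v + t' *\<^sub>R u)"
    unfolding K_def by (rule second_difference_mean_value[OF f h, of y v u]) (auto intro: inS)
  have swap: "y + h *\<^sub>R u + h *\<^sub>R v = y + h *\<^sub>R v + h *\<^sub>R u"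
    by (simp add: add_ac)
  have "h * h * K u v (y + s *\<^sub>R u + t *\<^sub>R v) = h * h * K v u (y + s' *\<^sub>R v + t' *\<^sub>R u)"
    using st(5) st'(5) unfolding swap by linarith
  then have "K u v (y + s *\<^sub>R u + t *\<^sub>R v) = K v u (y + s' *\<^sub>R v + t' *\<^sub>R u)"
    using h by simp
  moreover have "dist (K u v (y + s *\<^sub>R u + t *\<^sub>R v)) (K u v y) < e"
    using near[of s t u v] st d(2) by (intro d1(2)) auto
  moreover have "dist (K v u (y + s' *\<^sub>R v + t' *\<^sub>R u)) (K v u y) < e"
    using near[of s' t' v u] st' d(3) by (intro d2(2)) auto
  ultimately show False
    using dist_triangle3[of "K u v y" "K v u y" "K u v (y + s *\<^sub>R u + t *\<^sub>R v)"]
    unfolding e_def by simp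
qed

lemma second_derivative_symmetric:
  fixes f :: "'a::euclidean_space \<Rightarrow> 'b::euclidean_space"
  assumes S: "open S" "y \<in> S" and f: "C_k_on (Suc (Suc 0)) S f"
  shows "frechet_derivative (\<lambda>x. frechet_derivative f (at x) u) (at y) v =
         frechet_derivative (\<lambda>x. frechet_derivative f (at x) v) (at y) u"
proof (rule euclidean_eqI)
  fix b :: 'b
  let ?fb = "\<lambda>x. f x \<bullet> b"
  have fb: "C_k_on (Suc (Suc 0)) S ?fb"
    by (rule C_k_on_bounded_linear_comp[OF S(1) bounded_linear_inner_left f])
  have 1: "frechet_derivative ?fb (at x) w = frechet_derivative f (at x) w \<bullet> b" if "x \<in> S" for x w
    using frechet_derivative_at[OF bounded_linear.has_derivative[OF bounded_linear_inner_left
          C_k_on_has_derivative[OF f that]], of b] by metis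
  have "frechet_derivative (\<lambda>x. frechet_derivative ?fb (at x) w) (at y) w' =
        frechet_derivative (\<lambda>x. frechet_derivative f (at x) w) (at y) w' \<bullet> b" for w w'
  proof -
    have "frechet_derivative (\<lambda>x. frechet_derivative ?fb (at x) w) (at y) =
      frechet_derivative (\<lambda>x. frechet_derivative f (at x) w \<bullet> b) (at y)"
      by (rule frechet_derivative_cong_open[OF S]) (rule 1)
    moreover have "(\<lambda>x. frechet_derivative f (at x) w) differentiable (at y)"
      using f S by simp
    ultimately show ?thesis
      using frechet_derivative_at[OF bounded_linear.has_derivative[OF bounded_linear_inner_left
          has_derivative_frechet], of "\<lambda>x. frechet_derivative f (at x) w" y b] by metis
  qed
  then show "frechet_derivative (\<lambda>x. frechet_derivative f (at x) u) (at y) v \<bullet> b =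
      frechet_derivative (\<lambda>x. frechet_derivative f (at x) v) (at y) u \<bullet> b"
    using second_derivative_symmetric_real[OF S fb] by metis
qed

section \<open>Partial derivatives\<close>

lemma pd_eqI: "(f has_derivative D) (at y) \<Longrightarrow> pd i f y = D (axis i 1)"
  unfolding pd_def using frechet_derivative_at by metis

lemma pd_cong_open:
  "open S \<Longrightarrow> y \<in> S \<Longrightarrow> (\<And>z. z \<in> S \<Longrightarrow> f z = g z) \<Longrightarrow> pd i f y = pd i g y"
  unfolding pd_def using frechet_derivative_cong_open by metis

lemma smooth_on_pd: "smooth_on S f \<Longrightarrow> smooth_on S (pd i f)"
  unfolding pd_def[abs_def] by (rule smooth_on_frechet_derivative)

lemma pd_commute:
  fixes f :: "real ^ 'k::finite \<Rightarrow> 'b::euclidean_space"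
  shows "open S \<Longrightarrow> y \<in> S \<Longrightarrow> smooth_on S f \<Longrightarrow> pd i (pd j f) y = pd j (pd i f) y"
  unfolding pd_def[abs_def] smooth_on_def by (rule second_derivative_symmetric) blast+

lemma linear_eq_sum_axis:
  assumes "linear D"
  shows "D u = (\<Sum>i\<in>UNIV. (u $ i) *\<^sub>R D (axis i 1))"
proof -
  have "D u = D (\<Sum>i\<in>UNIV. (u $ i) *\<^sub>R axis i 1)"
    using basis_expansion[of u] by (simp add: scalar_mult_eq_scaleR)
  then show ?thesis
    by (simp only: linear_sum[OF assms] linear_scale[OF assms])
qed

lemma frechet_derivative_eq_sum_pd:
  "f differentiable (at y) \<Longrightarrow> frechet_derivative f (at y) u = (\<Sum>i\<in>UNIV. (u $ i) *\<^sub>R pd i f y)"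
  unfolding pd_def by (rule linear_eq_sum_axis[OF has_derivative_linear[OF has_derivative_frechet]])

lemma pd_bounded_linear:
  "bounded_linear L \<Longrightarrow> f differentiable (at y) \<Longrightarrow> pd i (\<lambda>z. L (f z)) y = L (pd i f y)"
  unfolding pd_def[of i f] by (rule pd_eqI[OF bounded_linear.has_derivative[OF _ has_derivative_frechet]])

lemma pd_bounded_bilinear:
  "bounded_bilinear B \<Longrightarrow> f differentiable (at y) \<Longrightarrow> g differentiable (at y) \<Longrightarrow>
    pd i (\<lambda>z. B (f z) (g z)) y = B (f y) (pd i g y) + B (pd i f y) (g y)"
  unfolding pd_def[of i f] pd_def[of i g]
  by (rule pd_eqI[OF bounded_bilinear.FDERIV[OF _ has_derivative_frechet has_derivative_frechet]])

lemmas pd_mult = pd_bounded_bilinear[OF bounded_bilinear_mult]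

lemma pd_sum:
  assumes "\<And>j. j \<in> I \<Longrightarrow> f j differentiable (at y)"
  shows "pd i (\<lambda>z. \<Sum>j\<in>I. f j z) y = (\<Sum>j\<in>I. pd i (f j) y)"
proof -
  have "((\<lambda>z. \<Sum>j\<in>I. f j z) has_derivative (\<lambda>v. \<Sum>j\<in>I. frechet_derivative (f j) (at y) v)) (at y)"
    by (intro has_derivative_sum has_derivative_frechet assms)
  then show ?thesis
    by (simp add: pd_eqI) (simp add: pd_def)
qed

lemma pd_compose:
  assumes "F differentiable (at y)" "X differentiable (at (F y))"
  shows "pd i (\<lambda>z. X (F z)) y = frechet_derivative X (at (F y)) (pd i F y)"
  unfolding pd_def[of i F]
  by (rule pd_eqI[OF has_derivative_compose[OF has_derivative_frechet[OF assms(1)] has_derivative_frechet[OF assms(2)]]])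

section \<open>Gram matrices and projections\<close>

lemma bounded_bilinear_lor: "bounded_bilinear (lor :: 'd::finite lspace \<Rightarrow> _)"
proof -
  have 1: "bounded_bilinear (\<lambda>v w :: 'd lspace. snd v \<bullet> snd w)"
    using bounded_bilinear.comp[OF bounded_bilinear_inner bounded_linear_snd bounded_linear_snd] .
  have 2: "bounded_bilinear (\<lambda>v w :: 'd lspace. (- fst v) * fst w)"
    using bounded_bilinear.comp[OF bounded_bilinear_mult
        bounded_linear_minus[OF bounded_linear_fst] bounded_linear_fst] .
  interpret A: bounded_bilinear "\<lambda>v w :: 'd lspace. snd v \<bullet> snd w" by (rule 1)
  interpret B: bounded_bilinear "\<lambda>v w :: 'd lspace. (- fst v) * fst w" by (rule 2)
  obtain K1 K2 where K: "\<And>(v :: 'd lspace) (w :: 'd lspace). norm (snd v \<bullet> snd w) \<le> norm v * norm w * K1"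
      "\<And>(v :: 'd lspace) (w :: 'd lspace). norm ((- fst v) * fst w) \<le> norm v * norm w * K2"
    using A.bounded B.bounded by blast
  have "norm (lor v w) \<le> norm v * norm w * (K1 + K2)" for v :: "'d lspace" and w :: "'d lspace"
    using norm_triangle_mono[OF K(2)[of v w] K(1)[of v w]] by (simp add: lor_def distrib_left add.commute)
  then have "\<exists>K. \<forall>v w :: 'd lspace. norm (lor v w) \<le> norm v * norm w * K"
    by blast
  then show ?thesis
    by unfold_locales (simp_all add: lor_def inner_add_left inner_add_right algebra_simps)
qed

lemma lor_commute: "lor v w = lor w v"
  by (simp add: lor_def inner_commute mult.commute)

interpretation lor: bounded_bilinear "lor :: 'd::finite lspace \<Rightarrow> 'd lspace \<Rightarrow> real"
  by (rule bounded_bilinear_lor)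

lemmas pd_lor = pd_bounded_bilinear[OF bounded_bilinear_lor]
lemmas smooth_on_lor = smooth_on_bounded_bilinear[OF _ bounded_bilinear_lor]

text \<open>Stated for a family of vectors instead of a metric, so that the same lemmas serve the
  frame of M and the coordinate frame of the hypersurface.\<close>

definition gmat :: "('k::finite \<Rightarrow> 'd::finite lspace) \<Rightarrow> real ^ 'k ^ 'k" where
  "gmat e = (\<chi> i j. lor (e i) (e j))"

lemma gram_pullback: "gram (pullback_metric lor_metric F) z = gmat (\<lambda>i. pd i F z)"
  by (simp add: gram_def gmat_def pullback_metric_def pd_def)

lemma ginv_pullback: "ginv (pullback_metric lor_metric F) z = matrix_inv (gmat (\<lambda>i. pd i F z))"
  by (simp add: ginv_def gram_pullback)

lemma matrix_inv_mult:
  fixes A :: "real ^ 'k ^ 'k"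
  assumes "invertible A"
  shows "A ** matrix_inv A = mat 1" "matrix_inv A ** A = mat 1"
  using someI_ex[OF assms[unfolded invertible_def]] unfolding matrix_inv_def by auto

lemma matrix_inv_sum:
  fixes A :: "real ^ 'k ^ 'k"
  assumes "invertible A"
  shows "(\<Sum>j\<in>UNIV. A $ i $ j * matrix_inv A $ j $ l) = (if i = l then 1 else 0)"
    "(\<Sum>j\<in>UNIV. matrix_inv A $ i $ j * A $ j $ l) = (if i = l then 1 else 0)"
  using matrix_inv_mult[OF assms] by (simp_all add: vec_eq_iff matrix_matrix_mult_def mat_def)

lemma matrix_inv_symmetric:
  fixes A :: "real ^ 'k ^ 'k"
  assumes "invertible A" "transpose A = A"
  shows "transpose (matrix_inv A) = matrix_inv A"
proof -
  have "transpose (matrix_inv A) ** A = mat 1"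
    using matrix_transpose_mul[of A "matrix_inv A"] matrix_inv_mult[OF assms(1)] assms(2)
    by (simp add: transpose_mat)
  then show ?thesis
    by (metis assms(1) matrix_inv_mult(1) matrix_mul_assoc matrix_mul_lid matrix_mul_rid)
qed

lemma transpose_gmat: "transpose (gmat e) = gmat e"
  by (simp add: gmat_def transpose_def vec_eq_iff lor_commute)

lemma gmat_inv_symmetric:
  "invertible (gmat e) \<Longrightarrow> matrix_inv (gmat e) $ i $ j = matrix_inv (gmat e) $ j $ i"
  using matrix_inv_symmetric[OF _ transpose_gmat, of e]
  by (simp add: transpose_def vec_eq_iff)

text \<open>A kernel vector of the Gram matrix is a combination orthogonal to the whole family.
  Since \<open>lor\<close> is indefinite, independence of the family alone would not exclude this;
  positivity does so for M, and a non-null normal does so for the hypersurface.\<close>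

lemma invertible_gmatI:
  fixes e :: "'k::finite \<Rightarrow> 'd::finite lspace"
  assumes "\<And>c. (\<And>l. lor (\<Sum>i\<in>UNIV. c $ i *\<^sub>R e i) (e l) = 0) \<Longrightarrow> c = 0"
  shows "invertible (gmat e)"
proof -
  have "c = 0" if "gmat e *v c = 0" for c
  proof (rule assms)
    fix l
    have "lor (\<Sum>i\<in>UNIV. c $ i *\<^sub>R e i) (e l) = (gmat e *v c) $ l"
      by (simp add: lor.sum_left lor.scaleR_left gmat_def matrix_vector_mult_def lor_commute[of "e l"] mult.commute)
    then show "lor (\<Sum>i\<in>UNIV. c $ i *\<^sub>R e i) (e l) = 0"
      using that by simp
  qed
  then show ?thesis
    using matrix_left_invertible_ker[of "gmat e"] invertible_left_inverse[of "gmat e"] by blast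
qed

text \<open>The \<open>lor\<close>-orthogonal projection onto the span of \<open>e\<close>, provided
  that the Gram matrix is invertible.\<close>

definition tan_proj :: "('k::finite \<Rightarrow> 'd::finite lspace) \<Rightarrow> 'd lspace \<Rightarrow> 'd lspace" where
  "tan_proj e v = (\<Sum>j\<in>UNIV. (\<Sum>i\<in>UNIV. matrix_inv (gmat e) $ i $ j * lor v (e i)) *\<^sub>R e j)"

lemma linear_tan_proj: "linear (tan_proj e)"
  by (rule linearI)
    (simp_all add: tan_proj_def lor.add_left lor.scaleR_left distrib_left sum.distrib scaleR_add_left
      scaleR_sum_right sum_distrib_left mult.left_commute)

lemma tan_proj_basis:
  assumes "invertible (gmat e)"
  shows "tan_proj e (e l) = e l"
proof -
  have "(\<Sum>i\<in>UNIV. matrix_inv (gmat e) $ i $ j * lor (e l) (e i)) = (if l = j then 1 else 0)" for j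
    using matrix_inv_sum(1)[OF assms, of l j] by (simp add: gmat_def mult.commute)
  then show ?thesis
    by (simp add: tan_proj_def if_distrib[of "\<lambda>c. c *\<^sub>R _"] cong: if_cong)
qed

lemma lor_tan_proj:
  assumes "invertible (gmat e)"
  shows "lor (tan_proj e v) (e l) = lor v (e l)"
proof -
  have "lor (tan_proj e v) (e l) = (\<Sum>j\<in>UNIV. \<Sum>i\<in>UNIV. lor v (e i) * (matrix_inv (gmat e) $ i $ j * gmat e $ j $ l))"
    by (simp add: tan_proj_def lor.sum_left lor.scaleR_left gmat_def sum_distrib_right sum_distrib_left mult_ac)
  also have "\<dots> = (\<Sum>i\<in>UNIV. lor v (e i) * (\<Sum>j\<in>UNIV. matrix_inv (gmat e) $ i $ j * gmat e $ j $ l))"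
    by (subst sum.swap) (simp add: sum_distrib_left)
  also have "\<dots> = lor v (e l)"
    by (simp add: matrix_inv_sum(2)[OF assms] if_distrib[of "\<lambda>c. _ * c"] cong: if_cong)
  finally show ?thesis .
qed

lemma tan_proj_lincomb:
  "invertible (gmat e) \<Longrightarrow> tan_proj e (\<Sum>i\<in>UNIV. c i *\<^sub>R e i) = (\<Sum>i\<in>UNIV. c i *\<^sub>R e i)"
  by (simp add: linear_sum[OF linear_tan_proj] linear_scale[OF linear_tan_proj] tan_proj_basis)

lemma tan_proj_orth: "(\<And>i. lor v (e i) = 0) \<Longrightarrow> tan_proj e v = 0"
  by (simp add: tan_proj_def)

section \<open>Smooth dependence of the inverse Gram matrix on the base point\<close>

lemma smooth_on_det:
  fixes A :: "'a::euclidean_space \<Rightarrow> real ^ 'k ^ 'k"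
  assumes "open S" "\<And>i j. smooth_on S (\<lambda>x. A x $ i $ j)"
  shows "smooth_on S (\<lambda>x. det (A x))"
  unfolding det_def by (intro smooth_on_sum smooth_on_mult smooth_on_prod smooth_on_const assms)

lemma smooth_on_matrix_inv:
  fixes A :: "'a::euclidean_space \<Rightarrow> real ^ 'k ^ 'k"
  assumes S: "open S" and A: "\<And>i j. smooth_on S (\<lambda>x. A x $ i $ j)"
    and inv: "\<And>x. x \<in> S \<Longrightarrow> invertible (A x)"
  shows "smooth_on S (\<lambda>x. matrix_inv (A x) $ i $ j)"
proof -
  have det: "det (A x) \<noteq> 0" if "x \<in> S" for x
    using inv[OF that] by (simp add: invertible_det_nz)
  \<comment> \<open>Cramer's rule for the \<open>j\<close>-th column of the inverse: each entry is a
    quotient of two determinants, which are polynomials in entries known to be smooth.\<close>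
  have eq: "matrix_inv (A x) $ i $ j =
      det (\<chi> k l. if l = i then axis j 1 $ k else A x $ k $ l) / det (A x)" if "x \<in> S" for x
  proof -
    have "A x *v (matrix_inv (A x) *v axis j 1) = axis j 1"
      using matrix_inv_mult(1)[OF inv[OF that]] by (simp add: matrix_vector_mul_assoc)
    then have "matrix_inv (A x) *v axis j 1 =
        (\<chi> i. det (\<chi> k l. if l = i then axis j 1 $ k else A x $ k $ l) / det (A x))"
      using cramer[OF det[OF that]] by blast
    moreover have "(matrix_inv (A x) *v axis j 1) $ i = matrix_inv (A x) $ i $ j"
      by (simp add: matrix_vector_mult_basis column_def)
    ultimately show ?thesis
      by simp
  qed
  have "smooth_on S (\<lambda>x. if l = i then axis j 1 $ k else A x $ k $ l)" for k l
    by (cases "l = i") (simp_all add: smooth_on_const A)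
  then have "smooth_on S (\<lambda>x. det (\<chi> k l. if l = i then axis j 1 $ k else A x $ k $ l) / det (A x))"
    by (intro smooth_on_divide smooth_on_det S A det) auto
  then show ?thesis
    by (subst smooth_on_cong[OF S eq])
qed

lemma smooth_on_ginv_pullback:
  assumes "open S" "smooth_on S F" "\<And>z. z \<in> S \<Longrightarrow> invertible (gmat (\<lambda>i. pd i F z))"
  shows "smooth_on S (\<lambda>z. ginv (pullback_metric lor_metric F) z $ i $ j)"
  unfolding ginv_pullback
  by (intro smooth_on_matrix_inv assms)
    (simp_all add: gmat_def smooth_on_lor[OF assms(1)] smooth_on_pd assms(2))

section \<open>Laplacian and covariant derivative of pulled back metrics\<close>

lemma pd_gram_pullback:
  assumes "smooth_on S F" "y \<in> S"
  shows "pd n (\<lambda>z. gram (pullback_metric lor_metric F) z $ i $ j) y =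
    lor (pd i F y) (pd n (pd j F) y) + lor (pd n (pd i F) y) (pd j F y)"
proof -
  have "pd i F differentiable (at y)" for i
    by (rule smooth_on_differentiable[OF smooth_on_pd]) (rule assms)+
  then show ?thesis
    by (simp add: gram_pullback gmat_def pd_lor)
qed

text \<open>The ambient space is flat, so the product rule gives six terms. Symmetry of second
  derivatives cancels four of them and the other two coincide. Hence the Christoffel symbols are the
  coefficients of the tangential part of the second derivative of \<open>F\<close>.\<close>

lemma christoffel_pullback:
  assumes S: "open S" "y \<in> S" and F: "smooth_on S F"
  shows "christoffel (pullback_metric lor_metric F) y i j l =
    (\<Sum>m\<in>UNIV. matrix_inv (gmat (\<lambda>i. pd i F y)) $ l $ m * lor (pd i (pd j F) y) (pd m F y))"
proof -
  have key: "lor (pd j F y) (pd i (pd m F) y) + lor (pd i (pd j F) y) (pd m F y) +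
      (lor (pd i F y) (pd j (pd m F) y) + lor (pd j (pd i F) y) (pd m F y)) -
      (lor (pd i F y) (pd m (pd j F) y) + lor (pd m (pd i F) y) (pd j F y)) =
      2 * lor (pd i (pd j F) y) (pd m F y)" for m
    by (simp add: pd_commute[OF S F, of j i] pd_commute[OF S F, of m i] pd_commute[OF S F, of m j]
        lor_commute)
  then show ?thesis
    unfolding christoffel_def pd_gram_pullback[OF F S(2)] ginv_pullback key
    by (simp add: sum_distrib_left)
qed

text \<open>The functional \<open>L\<close> stands for a coordinate of the ambient space, so one
  scalar statement yields every component of the vector Laplacian.\<close>

lemma divg_grad_pullback:
  fixes F :: "real ^ 'k::finite \<Rightarrow> 'd::finite lspace"
  assumes S: "open S" "y \<in> S" and F: "smooth_on S F"
    and inv: "\<And>z. z \<in> S \<Longrightarrow> invertible (gmat (\<lambda>i. pd i F z))"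
    and L: "bounded_linear L"
  defines "g \<equiv> pullback_metric lor_metric F"
  defines "B \<equiv> \<Sum>i\<in>UNIV. \<Sum>j\<in>UNIV. ginv g y $ i $ j *\<^sub>R pd i (pd j F) y"
  shows "divg g (grad g (\<lambda>z. L (F z))) y = L (B - tan_proj (\<lambda>i. pd i F y) B)"
proof -
  let ?f = "\<lambda>z. L (F z)"
  define W where "W i z = grad g ?f z $ i" for i z
  define e where "e i = pd i F y" for i
  define H where "H i j = pd i (pd j F) y" for i j
  define G where "G = ginv g y"
  define M where "M z = gram g z" for z
  have G_eq: "G = matrix_inv (gmat e)"
    by (simp add: G_def g_def ginv_pullback e_def[abs_def])
  have inv_e: "invertible (gmat e)"
    using inv[OF S(2)] by (simp add: e_def[abs_def])
  have M_y: "M y = gmat e"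
    by (simp add: M_def g_def gram_pullback e_def[abs_def])
  have f: "smooth_on S ?f"
    by (rule smooth_on_bounded_linear_comp[OF S(1) L F])
  have pd_f: "pd j ?f z = L (pd j F z)" if "z \<in> S" for j z
    by (rule pd_bounded_linear[OF L smooth_on_differentiable[OF F that]])
  have W_eq: "W i z = (\<Sum>j\<in>UNIV. ginv g z $ i $ j * pd j ?f z)" for i z
    by (simp add: W_def grad_def)
  have W: "smooth_on S (W i)" for i
    unfolding W_eq[abs_def] g_def
    by (intro smooth_on_sum smooth_on_mult smooth_on_ginv_pullback smooth_on_pd S F inv f)
  have Mdiff: "smooth_on S (\<lambda>z. M z $ m $ i)" for m i
    by (simp add: M_def g_def gram_pullback gmat_def smooth_on_lor[OF S(1)] smooth_on_pd F)
  \<comment> \<open>The gradient with its index lowered. Differentiating this identity, which holds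
    on all of \<open>S\<close>, avoids any formula for the derivative of the inverse matrix.\<close>
  have lower: "(\<Sum>i\<in>UNIV. M z $ m $ i * W i z) = L (pd m F z)" if z: "z \<in> S" for m z
  proof -
    have "(\<Sum>i\<in>UNIV. M z $ m $ i * W i z) =
        (\<Sum>i\<in>UNIV. \<Sum>j\<in>UNIV. (M z $ m $ i * matrix_inv (M z) $ i $ j) * pd j ?f z)"
      by (simp add: W_eq ginv_def M_def sum_distrib_left mult.assoc)
    also have "\<dots> = (\<Sum>j\<in>UNIV. (\<Sum>i\<in>UNIV. M z $ m $ i * matrix_inv (M z) $ i $ j) * pd j ?f z)"
      by (subst sum.swap) (simp add: sum_distrib_right)
    also have "\<dots> = pd m ?f z"
      using inv[OF z] by (subst matrix_inv_sum(1))
        (simp_all add: M_def g_def gram_pullback if_distrib[of "\<lambda>c. c * _"] cong: if_cong)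
    finally show ?thesis
      by (simp add: pd_f[OF z])
  qed
  have diff_lower: "(\<Sum>i\<in>UNIV. gmat e $ m $ i * pd n (W i) y) +
      (\<Sum>i\<in>UNIV. (lor (e m) (H n i) + lor (H n m) (e i)) * W i y) = L (H n m)" for m n
  proof -
    have "L (H n m) = pd n (\<lambda>z. L (pd m F z)) y"
      unfolding H_def
      by (rule pd_bounded_linear[OF L smooth_on_differentiable[OF smooth_on_pd[OF F] S(2)], symmetric])
    also have "\<dots> = pd n (\<lambda>z. \<Sum>i\<in>UNIV. M z $ m $ i * W i z) y"
      by (rule pd_cong_open[OF S]) (simp add: lower)
    also have "\<dots> = (\<Sum>i\<in>UNIV. pd n (\<lambda>z. M z $ m $ i * W i z) y)"
      by (rule pd_sum) (rule smooth_on_differentiable[OF smooth_on_mult[OF S(1) Mdiff W] S(2)])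
    also have "\<dots> = (\<Sum>i\<in>UNIV. M y $ m $ i * pd n (W i) y + pd n (\<lambda>z. M z $ m $ i) y * W i y)"
      by (rule sum.cong[OF refl], rule pd_mult)
        (rule smooth_on_differentiable[OF _ S(2)], rule Mdiff W)+
    finally show ?thesis
      by (simp add: M_y sum.distrib)
        (simp add: M_def g_def pd_gram_pullback[OF F S(2)] e_def H_def)
  qed
  \<comment> \<open>Contracting \<open>diff_lower\<close> with the inverse metric splits
    \<open>L B\<close> into three sums: the partial derivatives in the divergence, its Christoffel
    terms, and a remainder that turns out to be \<open>L (tan_proj e B)\<close>.\<close>
  have "L B = (\<Sum>n\<in>UNIV. \<Sum>m\<in>UNIV. G $ n $ m * L (H n m))"
    using L by (simp add: B_def G_def H_def linear_sum linear_scale bounded_linear.linear)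
  also have "\<dots> = (\<Sum>n\<in>UNIV. \<Sum>m\<in>UNIV. G $ n $ m * (\<Sum>i\<in>UNIV. gmat e $ m $ i * pd n (W i) y)) +
     (\<Sum>n\<in>UNIV. \<Sum>m\<in>UNIV. G $ n $ m * (\<Sum>i\<in>UNIV. (lor (e m) (H n i) + lor (H n m) (e i)) * W i y))"
    by (simp add: diff_lower[symmetric] distrib_left sum.distrib)
  also have "(\<Sum>n\<in>UNIV. \<Sum>m\<in>UNIV. G $ n $ m * (\<Sum>i\<in>UNIV. gmat e $ m $ i * pd n (W i) y)) =
      (\<Sum>n\<in>UNIV. pd n (W n) y)"
  proof (rule sum.cong[OF refl])
    fix n
    have "(\<Sum>m\<in>UNIV. G $ n $ m * (\<Sum>i\<in>UNIV. gmat e $ m $ i * pd n (W i) y)) =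
        (\<Sum>i\<in>UNIV. (\<Sum>m\<in>UNIV. G $ n $ m * gmat e $ m $ i) * pd n (W i) y)"
      by (simp add: sum_distrib_left sum_distrib_right mult.assoc) (rule sum.swap)
    also have "\<dots> = pd n (W n) y"
      by (simp add: G_eq matrix_inv_sum(2)[OF inv_e] if_distrib[of "\<lambda>c. c * _"] cong: if_cong)
    finally show "(\<Sum>m\<in>UNIV. G $ n $ m * (\<Sum>i\<in>UNIV. gmat e $ m $ i * pd n (W i) y)) = pd n (W n) y" .
  qed
  also have "(\<Sum>n\<in>UNIV. \<Sum>m\<in>UNIV. G $ n $ m * (\<Sum>i\<in>UNIV. (lor (e m) (H n i) + lor (H n m) (e i)) * W i y)) =
      (\<Sum>n\<in>UNIV. \<Sum>m\<in>UNIV. \<Sum>i\<in>UNIV. G $ n $ m * lor (H n i) (e m) * W i y) +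
      (\<Sum>n\<in>UNIV. \<Sum>m\<in>UNIV. \<Sum>i\<in>UNIV. G $ n $ m * lor (H n m) (e i) * W i y)"
    by (simp add: sum_distrib_left distrib_left distrib_right sum.distrib lor_commute mult.assoc)
  also have "(\<Sum>n\<in>UNIV. \<Sum>m\<in>UNIV. \<Sum>i\<in>UNIV. G $ n $ m * lor (H n i) (e m) * W i y) =
      (\<Sum>i\<in>UNIV. \<Sum>j\<in>UNIV. christoffel g y i j i * W j y)"
    unfolding g_def christoffel_pullback[OF S F]
    by (simp add: G_eq e_def[abs_def] H_def sum_distrib_right) (subst sum.swap, rule refl)
  also have "(\<Sum>n\<in>UNIV. \<Sum>m\<in>UNIV. \<Sum>i\<in>UNIV. G $ n $ m * lor (H n m) (e i) * W i y) =
      (\<Sum>i\<in>UNIV. lor B (e i) * W i y)"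
  proof -
    have "(\<Sum>n\<in>UNIV. \<Sum>m\<in>UNIV. \<Sum>i\<in>UNIV. G $ n $ m * lor (H n m) (e i) * W i y) =
        (\<Sum>n\<in>UNIV. \<Sum>i\<in>UNIV. \<Sum>m\<in>UNIV. G $ n $ m * lor (H n m) (e i) * W i y)"
      by (rule sum.cong[OF refl sum.swap])
    also have "\<dots> = (\<Sum>i\<in>UNIV. \<Sum>n\<in>UNIV. \<Sum>m\<in>UNIV. G $ n $ m * lor (H n m) (e i) * W i y)"
      by (rule sum.swap)
    also have "\<dots> = (\<Sum>i\<in>UNIV. lor B (e i) * W i y)"
      by (simp add: B_def G_def H_def lor.sum_left lor.scaleR_left sum_distrib_right)
    finally show ?thesis .
  qed
  also have "(\<Sum>i\<in>UNIV. lor B (e i) * W i y) = L (tan_proj e B)"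
  proof -
    have "L (tan_proj e B) = (\<Sum>j\<in>UNIV. \<Sum>i\<in>UNIV. G $ i $ j * lor B (e i) * L (e j))"
      using L by (simp add: tan_proj_def G_eq linear_sum linear_scale bounded_linear.linear sum_distrib_right)
    also have "\<dots> = (\<Sum>i\<in>UNIV. lor B (e i) * W i y)"
      by (subst sum.swap) (simp add: W_eq pd_f[OF S(2)] G_def e_def sum_distrib_left mult_ac)
    finally show ?thesis by simp
  qed
  finally have *: "L B = (\<Sum>n\<in>UNIV. pd n (W n) y) +
      ((\<Sum>i\<in>UNIV. \<Sum>j\<in>UNIV. christoffel g y i j i * W j y) + L (tan_proj e B))" .
  have "divg g (grad g ?f) y = (\<Sum>n\<in>UNIV. pd n (W n) y) +
      (\<Sum>i\<in>UNIV. \<Sum>j\<in>UNIV. christoffel g y i j i * W j y)"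
    by (simp add: divg_def W_def[abs_def] sum.distrib)
  also have "\<dots> = L B - L (tan_proj e B)"
    using * by simp
  finally show ?thesis
    using L by (simp add: linear_diff bounded_linear.linear e_def[abs_def])
qed

text \<open>This is the projection property of the Levi-Civita connection, for fields along
  \<open>F\<close>. In the flat derivative of the pushed-forward field, the terms that differentiate
  the coefficients are already tangent, and the terms with second derivatives of \<open>X\<close>
  project to the Christoffel terms.\<close>

lemma frechet_derivative_cov_along:
  fixes F :: "real ^ 'k::finite \<Rightarrow> real ^ 'n::finite" and X :: "real ^ 'n \<Rightarrow> 'd::finite lspace"
  assumes V: "open V" "F y \<in> V" and X: "smooth_on V X" and F: "F differentiable (at y)"
    and W: "W differentiable (at y)"
    and inv: "invertible (gmat (\<lambda>a. pd a X (F y)))"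
  shows "frechet_derivative X (at (F y)) (cov_along (pullback_metric lor_metric X) F W i y) =
    tan_proj (\<lambda>a. pd a X (F y)) (pd i (\<lambda>z. \<Sum>a\<in>UNIV. (W z $ a) *\<^sub>R pd a X (F z)) y)"
proof -
  define E where "E a = pd a X (F y)" for a
  define H where "H b c = pd b (pd c X) (F y)" for b c
  have inv_E: "invertible (gmat E)"
    using inv by (simp add: E_def[abs_def])
  interpret P: linear "tan_proj E"
    by (rule linear_tan_proj)
  have X': "X differentiable (at (F y))" and Xa: "pd a X differentiable (at (F y))" for a
    using smooth_on_differentiable[OF _ V(2)] X smooth_on_pd by blast+
  have comp: "(\<lambda>z. W z $ a) differentiable (at y)" for a
    using bounded_linear.has_derivative[OF bounded_linear_vec_nth has_derivative_frechet[OF W]]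
    by (auto simp: differentiable_def)
  have XF: "(\<lambda>z. pd a X (F z)) differentiable (at y)" for a
    using has_derivative_compose[OF has_derivative_frechet[OF F] has_derivative_frechet[OF Xa]]
    by (auto simp: differentiable_def)
  have pdXF: "pd i (\<lambda>z. pd a X (F z)) y = (\<Sum>b\<in>UNIV. (pd i F y $ b) *\<^sub>R H b a)" for a
    by (simp add: pd_compose[OF F Xa] frechet_derivative_eq_sum_pd[OF Xa] H_def)
  have "pd i (\<lambda>z. \<Sum>a\<in>UNIV. (W z $ a) *\<^sub>R pd a X (F z)) y =
      (\<Sum>a\<in>UNIV. pd i (\<lambda>z. (W z $ a) *\<^sub>R pd a X (F z)) y)"
    by (rule pd_sum) (rule differentiable_scaleR[OF comp XF])
  also have "\<dots> = (\<Sum>a\<in>UNIV. (W y $ a) *\<^sub>R (\<Sum>b\<in>UNIV. (pd i F y $ b) *\<^sub>R H b a) + (pd i W y $ a) *\<^sub>R E a)"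
    by (simp add: pd_bounded_bilinear[OF bounded_bilinear_scaleR comp XF] pdXF E_def
        pd_bounded_linear[OF bounded_linear_vec_nth W])
  finally have "tan_proj E (pd i (\<lambda>z. \<Sum>a\<in>UNIV. (W z $ a) *\<^sub>R pd a X (F z)) y) =
      (\<Sum>c\<in>UNIV. \<Sum>b\<in>UNIV. (pd i F y $ b * W y $ c) *\<^sub>R tan_proj E (H b c)) + (\<Sum>a\<in>UNIV. (pd i W y $ a) *\<^sub>R E a)"
    by (simp add: P.add P.sum P.scale tan_proj_basis[OF inv_E] sum.distrib scaleR_sum_right mult.commute)
  \<comment> \<open>\<open>christoffel\<close> and \<open>tan_proj\<close> contract opposite indices
    of the inverse Gram matrix; its symmetry reconciles them.\<close>
  moreover have "tan_proj E (H b c) = (\<Sum>a\<in>UNIV. christoffel (pullback_metric lor_metric X) (F y) b c a *\<^sub>R E a)" for b c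
    unfolding christoffel_pullback[OF V X] tan_proj_def
    by (simp add: H_def E_def[symmetric] gmat_inv_symmetric[OF inv_E, symmetric])
  moreover have "frechet_derivative X (at (F y)) (cov_along (pullback_metric lor_metric X) F W i y) =
      (\<Sum>a\<in>UNIV. (pd i W y $ a) *\<^sub>R E a) +
      (\<Sum>a\<in>UNIV. \<Sum>b\<in>UNIV. \<Sum>c\<in>UNIV. (christoffel (pullback_metric lor_metric X) (F y) b c a * pd i F y $ b * W y $ c) *\<^sub>R E a)"
    by (simp add: frechet_derivative_eq_sum_pd[OF X'] cov_along_def E_def scaleR_add_left sum.distrib scaleR_sum_left)
  moreover have "(\<Sum>a\<in>UNIV. \<Sum>b\<in>UNIV. \<Sum>c\<in>UNIV. (christoffel (pullback_metric lor_metric X) (F y) b c a * pd i F y $ b * W y $ c) *\<^sub>R E a) =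
     (\<Sum>c\<in>UNIV. \<Sum>b\<in>UNIV. \<Sum>a\<in>UNIV. (christoffel (pullback_metric lor_metric X) (F y) b c a * pd i F y $ b * W y $ c) *\<^sub>R E a)"
    (is "(\<Sum>a\<in>UNIV. \<Sum>b\<in>UNIV. \<Sum>c\<in>UNIV. ?t a b c) = _")
  proof -
    have "(\<Sum>a\<in>UNIV. \<Sum>b\<in>UNIV. \<Sum>c\<in>UNIV. ?t a b c) = (\<Sum>b\<in>UNIV. \<Sum>c\<in>UNIV. \<Sum>a\<in>UNIV. ?t a b c)"
      by (subst sum.swap) (intro sum.cong refl sum.swap)
    also have "\<dots> = (\<Sum>c\<in>UNIV. \<Sum>b\<in>UNIV. \<Sum>a\<in>UNIV. ?t a b c)"
      by (rule sum.swap)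
    finally show ?thesis .
  qed
  ultimately show ?thesis
    by (simp add: E_def[abs_def] scaleR_sum_right mult_ac)
qed

section \<open>Tangent spaces of \<open>Q(r)\<close>\<close>

definition P_vec :: "(real \<Rightarrow> real) \<Rightarrow> 'd::finite lspace \<Rightarrow> 'd lspace" where
  "P_vec r v = (r (fst v) * deriv r (fst v), snd v)"

lemma mem_Q_iff: "v \<in> Q J r \<longleftrightarrow> fst v \<in> J \<and> snd v \<bullet> snd v = (r (fst v))\<^sup>2"
  by (cases v) (simp add: Q_def inner_vec_def power2_eq_square)

lemma lor_P_vec_self:
  "v \<in> Q J r \<Longrightarrow> lor (P_vec r v) (P_vec r v) = (r (fst v))\<^sup>2 * (1 - (deriv r (fst v))\<^sup>2)"
  by (simp add: mem_Q_iff lor_def P_vec_def power2_eq_square algebra_simps)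

lemma admissible_factor_pos: "admissible J r \<Longrightarrow> t \<in> J \<Longrightarrow> 1 - (deriv r t)\<^sup>2 > 0"
  by (simp add: admissible_def abs_square_less_1)

lemma lor_P_vec_self_pos: "admissible J r \<Longrightarrow> v \<in> Q J r \<Longrightarrow> lor (P_vec r v) (P_vec r v) > 0"
  using admissible_factor_pos[of J r "fst v"] lor_P_vec_self[of v J r]
  by (auto simp: mem_Q_iff admissible_def intro!: mult_pos_pos)

text \<open>Obtained by differentiating |x|^2 = r(t)^2 along \<open>X\<close> and comparing the two
  expressions for the derivative.\<close>

lemma lor_pd_P_vec:
  fixes X :: "real ^ 'n::finite \<Rightarrow> 'd::finite lspace"
  assumes r: "smooth_on J r" and V: "open V" "z \<in> V" and X: "smooth_on V X" "X ` V \<subseteq> Q J r"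
  shows "lor (pd i X z) (P_vec r (X z)) = 0"
proof -
  have J: "fst (X z) \<in> J"
    using X(2) V by (auto simp: mem_Q_iff)
  let ?X' = "frechet_derivative X (at z)"
  have X': "(X has_derivative ?X') (at z)"
    by (rule smooth_on_has_derivative[OF X(1) V(2)])
  have snd': "((\<lambda>z. snd (X z)) has_derivative (\<lambda>u. snd (?X' u))) (at z)"
    by (rule bounded_linear.has_derivative[OF bounded_linear_snd X'])
  have fst': "((\<lambda>z. fst (X z)) has_derivative (\<lambda>u. fst (?X' u))) (at z)"
    by (rule bounded_linear.has_derivative[OF bounded_linear_fst X'])
  have r': "(r has_derivative (\<lambda>s. deriv r (fst (X z)) * s)) (at (fst (X z)))"
    by (rule has_field_derivative_imp_has_derivative[OF smooth_on_has_real_derivative[OF r J]])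
  have rX: "((\<lambda>z. r (fst (X z))) has_derivative (\<lambda>u. deriv r (fst (X z)) * fst (?X' u))) (at z)"
    using has_derivative_compose[OF fst' r'] .
  have "((\<lambda>z. snd (X z) \<bullet> snd (X z)) has_derivative
      (\<lambda>u. snd (X z) \<bullet> snd (?X' u) + snd (?X' u) \<bullet> snd (X z))) (at z)"
    by (rule has_derivative_inner[OF snd' snd'])
  moreover have "((\<lambda>z. snd (X z) \<bullet> snd (X z)) has_derivative
      (\<lambda>u. r (fst (X z)) * (deriv r (fst (X z)) * fst (?X' u)) +
        deriv r (fst (X z)) * fst (?X' u) * r (fst (X z)))) (at z)"
    by (rule has_derivative_transform_within_open[OF has_derivative_mult[OF rX rX] V])
      (use X(2) in \<open>auto simp: mem_Q_iff power2_eq_square\<close>)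
  ultimately have "(\<lambda>u. snd (X z) \<bullet> snd (?X' u) + snd (?X' u) \<bullet> snd (X z)) =
      (\<lambda>u. r (fst (X z)) * (deriv r (fst (X z)) * fst (?X' u)) +
        deriv r (fst (X z)) * fst (?X' u) * r (fst (X z)))"
    by (rule has_derivative_unique)
  from fun_cong[OF this, of "axis i 1"] show ?thesis
    by (simp add: lor_def P_vec_def pd_def inner_commute algebra_simps)
qed

lemma pd_P_vec:
  fixes X :: "real ^ 'n::finite \<Rightarrow> 'd::finite lspace"
  assumes r: "open J" "smooth_on J r" and X: "X differentiable (at z)" "fst (X z) \<in> J"
  defines "t \<equiv> fst (X z)"
  shows "(\<lambda>z. P_vec r (X z)) differentiable (at z)"
    "pd j (\<lambda>z. P_vec r (X z)) z = ((deriv (deriv r) t * r t + (deriv r t)\<^sup>2) * fst (pd j X z), snd (pd j X z))"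
proof -
  let ?X' = "frechet_derivative X (at z)"
  have X': "(X has_derivative ?X') (at z)"
    by (rule has_derivative_frechet[OF X(1)])
  have fst': "((\<lambda>z. fst (X z)) has_derivative (\<lambda>u. fst (?X' u))) (at z)"
    by (rule bounded_linear.has_derivative[OF bounded_linear_fst X'])
  have snd': "((\<lambda>z. snd (X z)) has_derivative (\<lambda>u. snd (?X' u))) (at z)"
    by (rule bounded_linear.has_derivative[OF bounded_linear_snd X'])
  have "((\<lambda>s. r s * deriv r s) has_derivative (\<lambda>s. (deriv (deriv r) t * r t + (deriv r t)\<^sup>2) * s)) (at (fst (X z)))"
    using DERIV_mult[OF smooth_on_has_real_derivative[OF r(2) X(2)]
        smooth_on_has_real_derivative[OF smooth_on_deriv[OF r] X(2)]]
    unfolding t_def by (intro has_field_derivative_imp_has_derivative)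
      (simp add: power2_eq_square add.commute)
  from has_derivative_compose[OF fst' this]
  have 1: "((\<lambda>z. r (fst (X z)) * deriv r (fst (X z))) has_derivative
      (\<lambda>u. (deriv (deriv r) t * r t + (deriv r t)\<^sup>2) * fst (?X' u))) (at z)" .
  have D: "((\<lambda>z. P_vec r (X z)) has_derivative
      (\<lambda>u. ((deriv (deriv r) t * r t + (deriv r t)\<^sup>2) * fst (?X' u), snd (?X' u)))) (at z)"
    unfolding P_vec_def by (rule has_derivative_Pair[OF 1 snd'])
  show "(\<lambda>z. P_vec r (X z)) differentiable (at z)"
    using D by (auto simp: differentiable_def)
  show "pd j (\<lambda>z. P_vec r (X z)) z = ((deriv (deriv r) t * r t + (deriv r t)\<^sup>2) * fst (pd j X z), snd (pd j X z))"
    by (simp add: pd_eqI[OF D]) (simp add: pd_def)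
qed

text \<open>Differentiating <e_j, P> = 0 moves the second derivative onto P, whose derivative
  multiplies the time part by (r r')' and keeps the spatial part. The spatial product exceeds the
  Lorentz product by the product of the time parts, whence the -1.\<close>

lemma lor_pd_pd_P_vec:
  fixes X :: "real ^ 'n::finite \<Rightarrow> 'd::finite lspace"
  assumes r: "open J" "smooth_on J r" and V: "open V" "z \<in> V" and X: "smooth_on V X" "X ` V \<subseteq> Q J r"
  defines "t \<equiv> fst (X z)"
  shows "lor (pd i (pd j X) z) (P_vec r (X z)) =
    (deriv (deriv r) t * r t + (deriv r t)\<^sup>2 - 1) * (fst (pd i X z) * fst (pd j X z))
      - lor (pd i X z) (pd j X z)"
proof -
  have J: "fst (X z) \<in> J"
    using X(2) V by (auto simp: mem_Q_iff)
  note P = pd_P_vec[OF r smooth_on_differentiable[OF X(1) V(2)] J]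
  have "pd i (\<lambda>z. lor (pd j X z) (P_vec r (X z))) z = pd i (\<lambda>z. 0) z"
    by (rule pd_cong_open[OF V]) (simp add: lor_pd_P_vec[OF r(2) V(1) _ X])
  then have "lor (pd j X z) (pd i (\<lambda>z. P_vec r (X z)) z) + lor (pd i (pd j X) z) (P_vec r (X z)) = 0"
    by (simp add: pd_lor[OF smooth_on_differentiable[OF smooth_on_pd[OF X(1)] V(2)] P(1)])
      (simp add: pd_def)
  then show ?thesis
    by (simp add: P(2) lor_def t_def inner_commute algebra_simps)
qed

section \<open>Splitting along a non-null vector and its orthogonal hyperplane\<close>

lemma lor_nondegenerate:
  assumes "\<And>w. lor u w = 0"
  shows "u = 0"
proof -
  have "fst u * fst u + snd u \<bullet> snd u = 0"
    using assms[of "(- fst u, snd u)"] by (simp add: lor_def)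
  then show ?thesis
    by (simp add: add_nonneg_eq_0_iff prod_eq_iff)
qed

context
  fixes E :: "'d::finite \<Rightarrow> 'd lspace" and p :: "'d lspace"
  assumes independent_E: "\<And>c. (\<Sum>a\<in>UNIV. c $ a *\<^sub>R E a) = 0 \<Longrightarrow> c = 0"
    and lor_p: "lor p p \<noteq> 0" and orth: "\<And>a. lor (E a) p = 0"
begin

text \<open>\<open>E\<close> spans the hyperplane orthogonal to \<open>p\<close>, because both have the same dimension.\<close>

lemma orthogonal_complement_eq_lincomb:
  assumes "lor w p = 0"
  obtains c where "w = (\<Sum>a\<in>UNIV. c $ a *\<^sub>R E a)"
proof -
  define comb where "comb c = (\<Sum>a\<in>UNIV. c $ a *\<^sub>R E a)" for c :: "real ^ 'd"
  have lin: "linear comb"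
    by (rule linearI) (simp_all add: comb_def scaleR_add_left sum.distrib scaleR_sum_right)
  have "inj comb"
    using independent_E linear_injective_0[OF lin] by (auto simp: comb_def)
  then have "dim (range comb) = CARD('d)"
    using dim_image_eq[OF lin, of UNIV] by simp
  moreover
  define p' where "p' = (- fst p, snd p)"
  have p': "lor v p = p' \<bullet> v" for v
    by (cases v) (simp add: p'_def lor_def inner_commute)
  have "p' \<noteq> 0"
    using lor_p p'[of p] by auto
  then have "dim {v. p' \<bullet> v = 0} = CARD('d)"
    by (simp add: dim_hyperplane)
  moreover have "range comb \<subseteq> {v. p' \<bullet> v = 0}"
    using orth by (auto simp: comb_def p'[symmetric] lor.sum_left lor.scaleR_left)
  ultimately have "range comb = {v. p' \<bullet> v = 0}"
    by (intro subspace_dim_equal) (simp_all add: linear_subspace_image[OF lin] subspace_hyperplane)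
  then have "w \<in> range comb"
    using assms p' by simp
  then show ?thesis
    using that by (auto simp: comb_def)
qed

lemma orthogonal_complement_split:
  obtains c where "v = (\<Sum>a\<in>UNIV. c $ a *\<^sub>R E a) + (lor v p / lor p p) *\<^sub>R p"
proof -
  have "lor (v - (lor v p / lor p p) *\<^sub>R p) p = 0"
    using lor_p by (simp add: lor.diff_left lor.scaleR_left)
  then obtain c where "v - (lor v p / lor p p) *\<^sub>R p = (\<Sum>a\<in>UNIV. c $ a *\<^sub>R E a)"
    by (rule orthogonal_complement_eq_lincomb)
  then show ?thesis
    by (intro that[of c]) (simp add: algebra_simps)
qed

text \<open>A combination orthogonal to every \<open>E l\<close> is also orthogonal to
  \<open>p\<close>, and these vectors together span the space. Nondegeneracy of \<open>lor\<close>
  makes the combination vanish.\<close>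

lemma invertible_gmat_hyperplane: "invertible (gmat E)"
proof (rule invertible_gmatI)
  fix c assume *: "lor (\<Sum>i\<in>UNIV. c $ i *\<^sub>R E i) (E l) = 0" for l
  have "lor (\<Sum>i\<in>UNIV. c $ i *\<^sub>R E i) v = 0" for v
  proof -
    obtain d where d: "v = (\<Sum>a\<in>UNIV. d $ a *\<^sub>R E a) + (lor v p / lor p p) *\<^sub>R p"
      by (rule orthogonal_complement_split)
    have "lor (\<Sum>i\<in>UNIV. c $ i *\<^sub>R E i) p = 0"
      by (simp add: lor.sum_left lor.scaleR_left orth)
    moreover have "lor (\<Sum>i\<in>UNIV. c $ i *\<^sub>R E i) (\<Sum>a\<in>UNIV. d $ a *\<^sub>R E a) = 0"
      by (simp add: lor.sum_right lor.scaleR_right *)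
    ultimately show ?thesis
      by (subst d) (simp add: lor.add_right lor.scaleR_right)
  qed
  then show "c = 0"
    using lor_nondegenerate independent_E by blast
qed

text \<open>The right-hand side mentions only \<open>p\<close>; this is what makes the mean
  curvature vector independent of the chosen parametrization.\<close>

lemma tan_proj_hyperplane: "tan_proj E v = v - (lor v p / lor p p) *\<^sub>R p"
proof -
  obtain c where c: "v = (\<Sum>a\<in>UNIV. c $ a *\<^sub>R E a) + (lor v p / lor p p) *\<^sub>R p"
    by (rule orthogonal_complement_split)
  have "tan_proj E p = 0"
    using orth by (intro tan_proj_orth) (simp add: lor_commute)
  then have "tan_proj E v = (\<Sum>a\<in>UNIV. c $ a *\<^sub>R E a)"
    by (subst c) (simp add: linear_add[OF linear_tan_proj] linear_scale[OF linear_tan_proj]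
        tan_proj_lincomb[OF invertible_gmat_hyperplane])
  then show ?thesis
    using c by (metis add_diff_cancel_right')
qed

end

section \<open>The mean curvature vector in coordinates\<close>

text \<open>Pulling \<open>lor\<close> back first by \<open>X\<close> and then by \<open>F\<close>
  gives the Gram matrix of the pushed-forward frame \<open>e\<close>, so the derivative of
  \<open>X\<close> carries the intrinsic normal part to the complement of
  \<open>tan_proj e\<close>.\<close>

lemma frechet_derivative_normal_part:
  fixes F :: "real ^ 'k::finite \<Rightarrow> real ^ 'n::finite" and X :: "real ^ 'n \<Rightarrow> 'd::finite lspace"
  assumes F: "F differentiable (at y)" and X: "X differentiable (at (F y))"
  defines "e \<equiv> \<lambda>i. frechet_derivative X (at (F y)) (pd i F y)"
  shows "ginv (pullback_metric (pullback_metric lor_metric X) F) y = matrix_inv (gmat e)"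
    "invertible (gmat e) \<Longrightarrow> frechet_derivative X (at (F y)) (normal_part (pullback_metric lor_metric X) F y u) =
      frechet_derivative X (at (F y)) u - tan_proj e (frechet_derivative X (at (F y)) u)"
proof -
  interpret D: linear "frechet_derivative X (at (F y))"
    using has_derivative_linear[OF has_derivative_frechet[OF X]] .
  show G: "ginv (pullback_metric (pullback_metric lor_metric X) F) y = matrix_inv (gmat e)"
    by (simp add: ginv_def gram_def pullback_metric_def pd_def gmat_def e_def)
  show "frechet_derivative X (at (F y)) (normal_part (pullback_metric lor_metric X) F y u) =
      frechet_derivative X (at (F y)) u - tan_proj e (frechet_derivative X (at (F y)) u)"
    if "invertible (gmat e)"
    by (simp add: normal_part_def G D.diff D.sum D.scale tan_proj_def scaleR_sum_left)
      (simp add: pullback_metric_def e_def, subst sum.swap, rule refl)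
qed

lemma mean_curv_hypersurface:
  fixes F :: "real ^ 'k::finite \<Rightarrow> real ^ 'd::finite" and X :: "real ^ 'd \<Rightarrow> 'd lspace"
  assumes S: "open S" "y \<in> S" and V: "open V" "F ` S \<subseteq> V"
    and F: "smooth_on S F" and X: "smooth_on V X" and Y: "\<And>z. z \<in> S \<Longrightarrow> X (F z) = Y z"
    and inj: "inj (frechet_derivative X (at (F y)))"
    and p: "lor p p \<noteq> 0" "\<And>a. lor (pd a X (F y)) p = 0"
    and inv: "invertible (gmat (\<lambda>i. pd i Y y))"
  defines "B \<equiv> \<Sum>i\<in>UNIV. \<Sum>j\<in>UNIV. matrix_inv (gmat (\<lambda>i. pd i Y y)) $ i $ j *\<^sub>R pd i (pd j Y) y"
  shows "real CARD('k) *\<^sub>R frechet_derivative X (at (F y)) (mean_curv (pullback_metric lor_metric X) F y) =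
    B - tan_proj (\<lambda>i. pd i Y y) B - (lor B p / lor p p) *\<^sub>R p"
proof -
  let ?D = "frechet_derivative X (at (F y))"
  let ?h = "pullback_metric lor_metric X"
  define e where "e i = pd i Y y" for i
  define E where "E a = pd a X (F y)" for a
  have FV: "F z \<in> V" if "z \<in> S" for z
    using V(2) that by auto
  have Xd: "X differentiable (at (F z))" and Fd: "F differentiable (at z)" if "z \<in> S" for z
    using smooth_on_differentiable[OF X FV[OF that]] smooth_on_differentiable[OF F that] by auto
  interpret D: linear ?D
    using has_derivative_linear[OF has_derivative_frechet[OF Xd[OF S(2)]]] .
  interpret Te: linear "tan_proj e"
    by (rule linear_tan_proj)
  interpret TE: linear "tan_proj E"
    by (rule linear_tan_proj)
  have chain: "pd j Y z = frechet_derivative X (at (F z)) (pd j F z)" if "z \<in> S" for j z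
  proof -
    have "pd j Y z = pd j (\<lambda>z. X (F z)) z"
      by (rule pd_cong_open[OF S(1) that]) (simp add: Y)
    then show ?thesis
      by (simp add: pd_compose[OF Fd[OF that] Xd[OF that]])
  qed
  have e: "e = (\<lambda>i. ?D (pd i F y))"
    by (simp add: e_def[abs_def] chain[OF S(2)])
  have ind: "c = 0" if "(\<Sum>a\<in>UNIV. c $ a *\<^sub>R E a) = 0" for c
  proof -
    have "?D c = ?D 0"
      using that by (simp add: frechet_derivative_eq_sum_pd[OF Xd[OF S(2)]] E_def)
    then show ?thesis
      by (rule injD[OF inj])
  qed
  have orthE: "lor (E a) p = 0" for a
    using p(2) by (simp add: E_def)
  note TE = tan_proj_hyperplane[of E, OF ind p(1) orthE]
  note invE = invertible_gmat_hyperplane[of E, OF ind p(1) orthE]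
  have inve: "invertible (gmat e)"
    using inv by (simp add: e_def[abs_def])
  \<comment> \<open>The frame of M is tangent to the hypersurface, hence orthogonal to its normal
    \<open>p\<close>.\<close>
  have orthe: "tan_proj e p = 0"
  proof (rule tan_proj_orth)
    fix i
    have "lor (?D (pd i F y)) p = 0"
      by (simp add: frechet_derivative_eq_sum_pd[OF Xd[OF S(2)]] lor.sum_left lor.scaleR_left p(2))
    then show "lor p (e i) = 0"
      by (simp add: e lor_commute)
  qed
  have cov: "?D (cov_along ?h F (pd j F) i y) = tan_proj E (pd i (pd j Y) y)" for i j
  proof -
    have "?D (cov_along ?h F (pd j F) i y) =
        tan_proj E (pd i (\<lambda>z. \<Sum>a\<in>UNIV. (pd j F z $ a) *\<^sub>R pd a X (F z)) y)"
      unfolding E_def[abs_def]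
      by (rule frechet_derivative_cov_along[OF V(1) FV[OF S(2)] X Fd[OF S(2)]])
        (use smooth_on_differentiable[OF smooth_on_pd[OF F] S(2)] invE in \<open>auto simp: E_def[abs_def]\<close>)
    \<comment> \<open>The field with components \<open>pd j F\<close> pushes forward to
      \<open>pd j Y\<close> on a whole neighbourhood of \<open>y\<close>, so the two may be
      differentiated alike.\<close>
    also have "pd i (\<lambda>z. \<Sum>a\<in>UNIV. (pd j F z $ a) *\<^sub>R pd a X (F z)) y = pd i (pd j Y) y"
      by (rule pd_cong_open[OF S]) (simp add: chain frechet_derivative_eq_sum_pd[OF Xd])
    finally show ?thesis .
  qed
  have G: "ginv (pullback_metric ?h F) y = matrix_inv (gmat e)"
    using frechet_derivative_normal_part(1)[OF Fd[OF S(2)] Xd[OF S(2)]] e by simp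
  have "?D (second_ff ?h F i j y) =
      tan_proj E (pd i (pd j Y) y) - tan_proj e (tan_proj E (pd i (pd j Y) y))" for i j
    using frechet_derivative_normal_part(2)[OF Fd[OF S(2)] Xd[OF S(2)]] inve
    by (simp add: second_ff_def e[symmetric] cov)
  then have "real CARD('k) *\<^sub>R ?D (mean_curv ?h F y) = tan_proj E B - tan_proj e (tan_proj E B)"
    by (simp add: mean_curv_def D.scale D.sum G B_def e_def[abs_def, symmetric]
        TE.sum TE.scale Te.sum Te.scale scaleR_diff_right sum_subtractf)
  \<comment> \<open>\<open>tan_proj E\<close> subtracts a multiple of \<open>p\<close>, and
    \<open>tan_proj e\<close> annihilates \<open>p\<close>. The two projections therefore contribute
    separately.\<close>
  also have "\<dots> = B - tan_proj e B - (lor B p / lor p p) *\<^sub>R p"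
    by (simp add: TE Te.diff Te.scale orthe)
  finally show ?thesis
    by (simp add: e_def[abs_def])
qed

section \<open>The norm of the gradient of the time coordinate\<close>

lemma tan_proj_span:
  assumes "invertible (gmat e)" "w \<in> span (range e)"
  shows "tan_proj e w = w"
proof -
  have "tan_proj e w = id w"
    by (rule linear_eq_on_span[OF linear_tan_proj linear_id _ assms(2)])
      (elim imageE, simp add: tan_proj_basis[OF assms(1)])
  then show ?thesis by simp
qed

lemma tan_proj_in_span: "tan_proj e w \<in> span (range e)"
  unfolding tan_proj_def by (intro span_sum span_scale span_base) auto

text \<open>The source of chart independence: two frames with the same span define the same
  projection.\<close>

lemma tan_proj_cong_span:
  assumes inv: "invertible (gmat e)" "invertible (gmat e')" and sp: "span (range e) = span (range e')"
  shows "tan_proj e v = tan_proj e' v"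
proof -
  \<comment> \<open>The residual of one projection is orthogonal to the common span and so is killed
    by the other, which in turn fixes the projected vector.\<close>
  have "lor (tan_proj e' v - v) w = 0" if "w \<in> span (range e')" for w
    using that
    by (induction rule: span_induct_alt)
      (auto simp: lor.zero_right lor.add_right lor.scaleR_right lor.diff_left lor_tan_proj[OF inv(2)])
  then have "lor (tan_proj e' v - v) (e i) = 0" for i
    using sp by (metis rangeI span_base)
  then have "tan_proj e (tan_proj e' v - v) = 0"
    by (rule tan_proj_orth)
  moreover have "tan_proj e (tan_proj e' v) = tan_proj e' v"
    using tan_proj_span[OF inv(1)] tan_proj_in_span[of e' v] sp by simp
  ultimately show ?thesis
    by (simp add: linear_diff[OF linear_tan_proj])
qed

text \<open>The gradient of the time coordinate is the tangential part of \<open>(- 1, 0)\<close>, since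
  \<open>lor (- 1, 0) v = fst v\<close>.\<close>

definition time_grad_sq :: "('k::finite \<Rightarrow> 'd::finite lspace) \<Rightarrow> real" where
  "time_grad_sq e = lor (tan_proj e (- 1, 0)) (tan_proj e (- 1, 0))"

lemma time_grad_sq_eq:
  assumes "invertible (gmat e)"
  shows "time_grad_sq e = (\<Sum>i\<in>UNIV. \<Sum>j\<in>UNIV. matrix_inv (gmat e) $ i $ j * (fst (e i) * fst (e j)))"
proof -
  have n0: "lor (- 1, 0) (e i) = fst (e i)" for i
    by (simp add: lor_def)
  have "time_grad_sq e = (\<Sum>j\<in>UNIV. (\<Sum>i\<in>UNIV. matrix_inv (gmat e) $ i $ j * fst (e i)) * lor (e j) (tan_proj e (- 1, 0)))"
    unfolding time_grad_sq_def
    by (subst (1) tan_proj_def) (simp add: n0 lor.sum_left lor.scaleR_left)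
  also have "\<dots> = (\<Sum>j\<in>UNIV. \<Sum>i\<in>UNIV. matrix_inv (gmat e) $ i $ j * (fst (e i) * fst (e j)))"
    by (simp add: lor_commute[of "e _" "tan_proj e _"] lor_tan_proj[OF assms] n0 sum_distrib_right mult.assoc)
  finally show ?thesis
    by (subst sum.swap)
qed

lemma grad_norm_time_sq:
  fixes F :: "real ^ 'k::finite \<Rightarrow> 'd::finite lspace"
  assumes F: "F differentiable (at y)" and inv: "invertible (gmat (\<lambda>i. pd i F y))"
  defines "g \<equiv> pullback_metric lor_metric F"
  defines "v \<equiv> grad g (\<lambda>z. fst (F z)) y"
  shows "g y v v = time_grad_sq (\<lambda>i. pd i F y)"
proof -
  have "frechet_derivative F (at y) v = tan_proj (\<lambda>i. pd i F y) (- 1, 0)"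
    unfolding frechet_derivative_eq_sum_pd[OF F] tan_proj_def
    by (simp add: v_def grad_def g_def ginv_pullback pd_bounded_linear[OF bounded_linear_fst F]
        lor_def gmat_inv_symmetric[OF inv, symmetric])
  then show ?thesis
    by (simp add: g_def pullback_metric_def time_grad_sq_def)
qed

lemma lor_trace_second_derivative_P_vec:
  fixes Y :: "real ^ 'k::finite \<Rightarrow> 'd::finite lspace"
  assumes r: "open J" "smooth_on J r" and S: "open S" "y \<in> S" and Y: "smooth_on S Y" "Y ` S \<subseteq> Q J r"
    and inv: "invertible (gmat (\<lambda>i. pd i Y y))"
  defines "B \<equiv> \<Sum>i\<in>UNIV. \<Sum>j\<in>UNIV. matrix_inv (gmat (\<lambda>i. pd i Y y)) $ i $ j *\<^sub>R pd i (pd j Y) y"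
  defines "t \<equiv> fst (Y y)"
  shows "lor B (P_vec r (Y y)) =
    - (real CARD('k) - (deriv (deriv r) t * r t + (deriv r t)\<^sup>2 - 1) * time_grad_sq (\<lambda>i. pd i Y y))"
proof -
  define G where "G = matrix_inv (gmat (\<lambda>i. pd i Y y))"
  define \<rho> where "\<rho> = deriv (deriv r) t * r t + (deriv r t)\<^sup>2 - 1"
  \<comment> \<open>The metric contracted with its inverse is the trace of the identity, which is
    the origin of k in the bracket.\<close>
  have trace: "(\<Sum>i\<in>UNIV. \<Sum>j\<in>UNIV. G $ i $ j * lor (pd i Y y) (pd j Y y)) = real CARD('k)"
    using matrix_inv_sum(2)[OF inv] by (simp add: G_def gmat_def lor_commute)
  have "lor B (P_vec r (Y y)) =
      (\<Sum>i\<in>UNIV. \<Sum>j\<in>UNIV. G $ i $ j * (\<rho> * (fst (pd i Y y) * fst (pd j Y y)) - lor (pd i Y y) (pd j Y y)))"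
    by (simp add: B_def G_def lor.sum_left lor.scaleR_left lor_pd_pd_P_vec[OF r S Y] \<rho>_def t_def)
  also have "\<dots> = \<rho> * time_grad_sq (\<lambda>i. pd i Y y) - real CARD('k)"
    by (simp add: time_grad_sq_eq[OF inv] G_def[symmetric] right_diff_distrib sum_subtractf trace
        sum_distrib_left mult.left_commute)
  finally show ?thesis
    by (simp add: \<rho>_def)
qed

section \<open>Parametrizations\<close>

text \<open>\<open>param_at\<close> is a Hilbert choice and is meaningful only if some
  parametrization exists. Since r > 0, some spatial coordinate \<open>a\<close> of \<open>s\<close>
  is nonzero; the equation of \<open>Q\<close> is solved for it, and the freed slot \<open>a\<close>
  of the parameter holds the time.\<close>

lemma parametrization_Q_exists:
  fixes s :: "'d::finite lspace"
  assumes J: "open J" and r: "admissible J r" and s: "s \<in> Q J r"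
  shows "\<exists>V X. parametrization (Q J r) V X \<and> s \<in> X ` V"
proof -
  have rs: "smooth_on J r" and rpos: "\<And>t. t \<in> J \<Longrightarrow> r t > 0"
    using r by (auto simp: admissible_def)
  have "snd s \<noteq> 0"
    using s rpos[of "fst s"] by (auto simp: mem_Q_iff)
  then obtain a where a: "snd s $ a \<noteq> 0"
    by (auto simp: vec_eq_iff)
  define \<sigma> where "\<sigma> = sgn (snd s $ a)"
  have \<sigma>: "\<sigma> * \<sigma> = 1"
    using a by (simp add: \<sigma>_def sgn_if)
  \<comment> \<open>The square of the eliminated coordinate. The sign \<open>\<sigma>\<close>
    selects the sheet that contains \<open>s\<close>.\<close>
  define g where "g v = (r (v $ a))\<^sup>2 - (\<Sum>b\<in>UNIV - {a}. (v $ b)\<^sup>2)" for v :: "real ^ 'd"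
  define W where "W = {v :: real ^ 'd. v $ a \<in> J}"
  define V where "V = {v \<in> W. g v > 0}"
  define X where "X v = (v $ a, \<chi> b. if b = a then \<sigma> * sqrt (g v) else v $ b)" for v
  \<comment> \<open>Reads the parameter back off a point. It is linear, hence one globally smooth
    extension of the inverse.\<close>
  define f where "f z = (\<chi> b. if b = a then fst z else snd z $ b)" for z :: "'d lspace"
  have W: "open W"
    unfolding W_def using continuous_open_vimage[OF J, of "\<lambda>v. v $ a"]
    by (simp add: vimage_def continuous_intros)
  have comp: "smooth_on S (\<lambda>v :: real ^ 'd. v $ b)" if "open S" for S b
    by (rule smooth_on_bounded_linear[OF that bounded_linear_vec_nth])
  have g: "smooth_on W g"
    unfolding g_def
    by (intro smooth_on_diff smooth_on_power2 smooth_on_sum W comp smooth_on_compose[OF W comp rs])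
      (auto simp: W_def)
  have "open (g -` {0<..} \<inter> W)"
    using smooth_on_imp_continuous_on[OF g] continuous_on_open_vimage[OF W] open_greaterThan by blast
  moreover have "g -` {0<..} \<inter> W = V"
    by (auto simp: V_def)
  ultimately have V: "open V"
    by simp
  have Xs: "smooth_on V X"
    unfolding X_def
  proof (intro smooth_on_Pair smooth_on_vec_lambda V comp)
    fix b
    have "smooth_on V (\<lambda>v. \<sigma> * sqrt (g v))"
      by (intro smooth_on_mult smooth_on_const smooth_on_sqrt V smooth_on_subset[OF g])
        (auto simp: V_def)
    then show "smooth_on V (\<lambda>v. if b = a then \<sigma> * sqrt (g v) else v $ b)"
      by (cases "b = a") (simp_all add: comp V)
  qed
  have fX: "f (X v) = v" for v
    by (simp add: f_def X_def vec_eq_iff)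
  have inj: "inj_on X V"
    using fX by (metis inj_on_inverseI)
  have fs: "smooth_on UNIV f"
    unfolding f_def
  proof (intro smooth_on_vec_lambda open_UNIV)
    fix b
    have "smooth_on UNIV (\<lambda>z :: 'd lspace. snd z $ b)" "smooth_on UNIV (fst :: 'd lspace \<Rightarrow> real)"
      by (auto intro: smooth_on_bounded_linear bounded_linear_fst
          bounded_linear_compose[OF bounded_linear_vec_nth bounded_linear_snd])
    then show "smooth_on UNIV (\<lambda>z :: 'd lspace. if b = a then fst z else snd z $ b)"
      by (cases "b = a") simp_all
  qed
  have split: "x \<bullet> x = (x $ a)\<^sup>2 + (\<Sum>b\<in>UNIV - {a}. (x $ b)\<^sup>2)" for x :: "real ^ 'd"
    by (simp add: inner_vec_def power2_eq_square sum.remove[of UNIV a])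
  have image: "X ` V = Q J r \<inter> {z. \<sigma> * snd z $ a > 0}"
  proof (intro set_eqI iffI)
    fix z assume "z \<in> X ` V"
    then obtain v where v: "v \<in> V" "z = X v"
      by blast
    have "(\<Sum>b\<in>UNIV - {a}. (snd z $ b)\<^sup>2) = (\<Sum>b\<in>UNIV - {a}. (v $ b)\<^sup>2)"
      by (rule sum.cong) (auto simp: v X_def)
    moreover have "(snd z $ a)\<^sup>2 = g v"
      using v \<sigma> by (simp add: X_def power_mult_distrib V_def power2_eq_square[of \<sigma>])
    ultimately have "snd z \<bullet> snd z = (r (fst z))\<^sup>2"
      by (simp add: split) (simp add: g_def v(2) X_def)
    moreover have "\<sigma> * snd z $ a > 0" "fst z \<in> J"
      using v \<sigma> by (simp_all add: X_def V_def W_def mult.assoc[symmetric])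
    ultimately show "z \<in> Q J r \<inter> {z. \<sigma> * snd z $ a > 0}"
      by (simp add: mem_Q_iff)
  next
    fix z assume z: "z \<in> Q J r \<inter> {z. \<sigma> * snd z $ a > 0}"
    have "(\<Sum>b\<in>UNIV - {a}. (f z $ b)\<^sup>2) = (\<Sum>b\<in>UNIV - {a}. (snd z $ b)\<^sup>2)"
      by (rule sum.cong) (auto simp: f_def)
    then have gz: "g (f z) = (snd z $ a)\<^sup>2"
      using z by (simp add: g_def mem_Q_iff split) (simp add: f_def)
    have za: "snd z $ a \<noteq> 0"
      using z by auto
    have "f z \<in> V"
      using z za gz by (auto simp: V_def W_def mem_Q_iff f_def)
    \<comment> \<open>The square root returns the absolute value of the coordinate, which on this
      sheet is \<open>\<sigma>\<close> times the coordinate; a second factor \<open>\<sigma>\<close>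
      restores it.\<close>
    moreover have "\<sigma> * sqrt (g (f z)) = snd z $ a"
    proof -
      have "\<bar>\<sigma>\<bar> = 1"
        using a by (simp add: \<sigma>_def abs_sgn_eq)
      then have "\<bar>snd z $ a\<bar> = \<sigma> * snd z $ a"
        using z by (metis IntD2 abs_mult abs_of_pos mem_Collect_eq mult_1)
      then show ?thesis
        using \<sigma> by (simp add: gz mult.assoc[symmetric])
    qed
    then have "X (f z) = z"
      by (simp add: X_def vec_eq_iff prod_eq_iff) (simp add: f_def)
    ultimately show "z \<in> X ` V"
      by (metis imageI)
  qed
  have "open {z :: 'd lspace. \<sigma> * snd z $ a > 0}"
    by (intro open_Collect_less continuous_intros)
  then have openin: "openin (top_of_set (Q J r)) (X ` V)"
    unfolding image by (rule openin_open_Int)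
  have "\<forall>z\<in>UNIV \<inter> X ` V. f z = inv_into V X z"
    using fX inj by auto
  then have "parametrization (Q J r) V X"
    unfolding parametrization_def using V Xs inj openin fs by blast
  moreover have "s \<in> X ` V"
    unfolding image using s a by (simp add: \<sigma>_def sgn_if)
  ultimately show ?thesis
    by blast
qed

lemma parametrization_param_at:
  assumes "\<exists>V X. parametrization S V X \<and> s \<in> X ` V"
  shows "parametrization S (fst (param_at S s)) (snd (param_at S s))"
    "s \<in> snd (param_at S s) ` fst (param_at S s)"
proof -
  have "\<exists>c. case c of (V, X) \<Rightarrow> parametrization S V X \<and> s \<in> X ` V"
    using assms by auto
  from someI_ex[OF this]
  show "parametrization S (fst (param_at S s)) (snd (param_at S s))"
    "s \<in> snd (param_at S s) ` fst (param_at S s)"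
    unfolding param_at_def by (auto split: prod.splits)
qed

text \<open>Near \<open>x\<close> the smooth extension \<open>f\<close> of the inverse satisfies
  f(X(z)) = z. By the chain rule the derivative of \<open>X\<close> has a left inverse.\<close>

lemma parametrization_inj_derivative:
  assumes X: "parametrization S V X" and x: "x \<in> V"
  shows "inj (frechet_derivative X (at x))"
proof -
  have V: "open V" and Xs: "smooth_on V X" and inj: "inj_on X V"
    using X by (auto simp: parametrization_def)
  have "X x \<in> X ` V"
    using x by blast
  then obtain W f where W: "open W" "X x \<in> W" "smooth_on W f" "\<forall>z\<in>W \<inter> X ` V. f z = inv_into V X z"
    using X unfolding parametrization_def by blast
  have op: "open (X -` W \<inter> V)"
    using smooth_on_imp_continuous_on[OF Xs] continuous_on_open_vimage[OF V] W(1) by blast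
  have 1: "((\<lambda>z. f (X z)) has_derivative
      (\<lambda>u. frechet_derivative f (at (X x)) (frechet_derivative X (at x) u))) (at x)"
    by (rule has_derivative_compose[OF smooth_on_has_derivative[OF Xs x] smooth_on_has_derivative[OF W(3,2)]])
  have "((\<lambda>z. z) has_derivative
      (\<lambda>u. frechet_derivative f (at (X x)) (frechet_derivative X (at x) u))) (at x)"
    by (rule has_derivative_transform_within_open[OF 1 op]) (use W x inj in auto)
  then have "(\<lambda>u. frechet_derivative f (at (X x)) (frechet_derivative X (at x) u)) = (\<lambda>u. u)"
    using has_derivative_unique has_derivative_ident by blast
  then show ?thesis
    by (metis injI)
qed

text \<open>The domain is shrunk until \<open>Y\<close> stays both in the image of \<open>X\<close>
  and in a set on which the inverse extends smoothly. There the lift is a composition of smooth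
  maps.\<close>

lemma parametrization_lift:
  assumes X: "parametrization S V X" and D: "open D" "y \<in> D" and Y: "smooth_on D Y" "Y ` D \<subseteq> S"
    and y: "Y y \<in> X ` V"
  obtains S' where "open S'" "y \<in> S'" "S' \<subseteq> D" "smooth_on S' (inv_into V X \<circ> Y)"
    "(inv_into V X \<circ> Y) ` S' \<subseteq> V" "\<And>z. z \<in> S' \<Longrightarrow> X ((inv_into V X \<circ> Y) z) = Y z"
proof -
  obtain R where R: "open R" "X ` V = S \<inter> R"
    using X by (auto simp: parametrization_def openin_open)
  obtain W f where W: "open W" "Y y \<in> W" "smooth_on W f" "\<forall>z\<in>W \<inter> X ` V. f z = inv_into V X z"
    using X y unfolding parametrization_def by blast
  define S' where "S' = Y -` (R \<inter> W) \<inter> D"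
  have S': "open S'"
    unfolding S'_def
    using smooth_on_imp_continuous_on[OF Y(1)] continuous_on_open_vimage[OF D(1)] R(1) W(1) by blast
  have mem: "Y z \<in> X ` V" "Y z \<in> W" if "z \<in> S'" for z
    using that R(2) Y(2) by (auto simp: S'_def)
  show ?thesis
  proof
    show "open S'"
      by (rule S')
    show "y \<in> S'"
      using D(2) y W(2) R(2) by (auto simp: S'_def)
    show "S' \<subseteq> D"
      by (auto simp: S'_def)
    have "smooth_on S' (\<lambda>z. f (Y z))"
      by (rule smooth_on_compose[OF S' smooth_on_subset[OF Y(1)] W(3)]) (auto simp: S'_def)
    then show "smooth_on S' (inv_into V X \<circ> Y)"
      using W(4) mem by (subst smooth_on_cong[OF S', of _ "\<lambda>z. f (Y z)"]) auto
    show "(inv_into V X \<circ> Y) ` S' \<subseteq> V"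
      using mem(1) by (auto intro: inv_into_into)
    show "X ((inv_into V X \<circ> Y) z) = Y z" if "z \<in> S'" for z
      using mem(1)[OF that] by (simp add: f_inv_into_f)
  qed
qed

section \<open>Charts\<close>

lemma smooth_manifold_chartD:
  assumes M: "smooth_manifold T A" and c: "(U, \<phi>) \<in> A"
  shows "openin T U" "U \<subseteq> topspace T" "open (\<phi> ` U)" "inj_on \<phi> U"
    "\<And>W. openin T W \<Longrightarrow> open (\<phi> ` (U \<inter> W))"
proof -
  have U: "openin T U" and op: "open (\<phi> ` U)"
    and hom: "homeomorphic_map (subtopology T U) (top_of_set (\<phi> ` U)) \<phi>"
    using M c by (auto simp: smooth_manifold_def)
  show "openin T U" "U \<subseteq> topspace T" "open (\<phi> ` U)"
    using U op openin_subset by auto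
  then have "topspace (subtopology T U) = U"
    by auto
  then show "inj_on \<phi> U"
    using homeomorphic_imp_injective_map[OF hom] by simp
  show "open (\<phi> ` (U \<inter> W))" if "openin T W" for W
  proof -
    have "openin (subtopology T U) (U \<inter> W)"
      using that by (simp add: openin_subtopology_Int2)
    then have "openin (top_of_set (\<phi> ` U)) (\<phi> ` (U \<inter> W))"
      using homeomorphic_imp_open_map[OF hom] by (simp add: open_map_def)
    then show ?thesis
      using op by (simp add: openin_open_eq)
  qed
qed

lemma chart_at_mem:
  assumes "smooth_manifold T A" "p \<in> topspace T"
  shows "chart_at A p \<in> A" "p \<in> fst (chart_at A p)"
proof -
  have "p \<in> (\<Union>(U, \<phi>)\<in>A. U)"
    using assms by (auto simp: smooth_manifold_def)
  then have "\<exists>c. c \<in> A \<and> p \<in> fst c"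
    by force
  from someI_ex[OF this] show "chart_at A p \<in> A" "p \<in> fst (chart_at A p)"
    by (auto simp: chart_at_def)
qed

lemma chart_rep_apply: "inj_on \<phi> U \<Longrightarrow> p \<in> U \<Longrightarrow> chart_rep (U, \<phi>) f (\<phi> p) = f p"
  by (simp add: chart_rep_def)

text \<open>A combination orthogonal to the frame is orthogonal to itself, which a positive definite
  metric permits only for the zero vector.\<close>

lemma invertible_gmat_spacelike:
  assumes F: "F differentiable (at z)"
    and pos: "\<And>u. u \<noteq> 0 \<Longrightarrow> pullback_metric lor_metric F z u u > 0"
  shows "invertible (gmat (\<lambda>i. pd i F z))"
proof (rule invertible_gmatI)
  fix c assume *: "lor (\<Sum>i\<in>UNIV. c $ i *\<^sub>R pd i F z) (pd l F z) = 0" for l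
  have "lor (\<Sum>i\<in>UNIV. c $ i *\<^sub>R pd i F z) (\<Sum>l\<in>UNIV. c $ l *\<^sub>R pd l F z) = 0"
    by (simp add: lor.sum_right[of _ "\<lambda>l. c $ l *\<^sub>R pd l F z"] lor.scaleR_right *)
  then have "pullback_metric lor_metric F z c c = 0"
    by (simp add: pullback_metric_def frechet_derivative_eq_sum_pd[OF F])
  then show "c = 0"
    using pos[of c] by force
qed

lemma spacelike_immersion_chartD:
  assumes M: "smooth_manifold T A" and \<Psi>: "spacelike_immersion T A S \<Psi>" and c: "(U, \<phi>) \<in> A"
  shows "smooth_on (\<phi> ` U) (chart_rep (U, \<phi>) \<Psi>)" "chart_rep (U, \<phi>) \<Psi> ` \<phi> ` U \<subseteq> S"
    "\<And>z. z \<in> \<phi> ` U \<Longrightarrow> invertible (gmat (\<lambda>i. pd i (chart_rep (U, \<phi>) \<Psi>) z))"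
    "\<And>z u. z \<in> \<phi> ` U \<Longrightarrow> pullback_metric lor_metric (chart_rep (U, \<phi>) \<Psi>) z u u \<ge> 0"
proof -
  show sm: "smooth_on (\<phi> ` U) (chart_rep (U, \<phi>) \<Psi>)"
    using \<Psi> c by (auto simp: spacelike_immersion_def smooth_map_def)
  have "chart_rep (U, \<phi>) \<Psi> (\<phi> u) \<in> S" if "u \<in> U" for u
  proof -
    have "\<Psi> u \<in> S"
      using smooth_manifold_chartD(2)[OF M c] \<Psi> that by (auto simp: spacelike_immersion_def)
    then show ?thesis
      using chart_rep_apply[OF smooth_manifold_chartD(4)[OF M c] that, of \<Psi>] by simp
  qed
  then show "chart_rep (U, \<phi>) \<Psi> ` \<phi> ` U \<subseteq> S"
    by blast
  have pos: "pullback_metric lor_metric (chart_rep (U, \<phi>) \<Psi>) z u u > 0" if "z \<in> \<phi> ` U" "u \<noteq> 0" for z u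
    using \<Psi> c that by (fastforce simp: spacelike_immersion_def)
  show "invertible (gmat (\<lambda>i. pd i (chart_rep (U, \<phi>) \<Psi>) z))" if "z \<in> \<phi> ` U" for z
    using invertible_gmat_spacelike[OF smooth_on_differentiable[OF sm that]] pos[OF that] by blast
  show "pullback_metric lor_metric (chart_rep (U, \<phi>) \<Psi>) z u u \<ge> 0" if "z \<in> \<phi> ` U" for z u
  proof (cases "u = 0")
    case True
    then show ?thesis
      by (simp add: pullback_metric_def linear_0[OF has_derivative_linear[OF
            smooth_on_has_derivative[OF sm that]]] lor.zero_left)
  next
    case False
    then show ?thesis
      using pos[OF that] by (simp add: less_imp_le)
  qed
qed

text \<open>By the chain rule each coordinate vector of one chart is a combination of those of the
  other. Exchanging the charts gives the reverse inclusion.\<close>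

lemma span_pd_transition:
  assumes M: "smooth_manifold T A" and c: "(U, \<phi>) \<in> A" "(V, \<psi>) \<in> A"
    and \<Psi>: "smooth_map A \<Psi>" and p: "p \<in> U" "p \<in> V"
  shows "span (range (\<lambda>i. pd i (chart_rep (U, \<phi>) \<Psi>) (\<phi> p))) \<subseteq>
    span (range (\<lambda>i. pd i (chart_rep (V, \<psi>) \<Psi>) (\<psi> p)))"
proof -
  define D where "D = \<phi> ` (U \<inter> V)"
  define \<tau> where "\<tau> = chart_rep (U, \<phi>) \<psi>"
  let ?F = "chart_rep (U, \<phi>) \<Psi>" and ?F' = "chart_rep (V, \<psi>) \<Psi>"
  note inj = smooth_manifold_chartD(4)[OF M c(1)] smooth_manifold_chartD(4)[OF M c(2)]
  have D: "open D" "\<phi> p \<in> D"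
    using smooth_manifold_chartD(5)[OF M c(1) smooth_manifold_chartD(1)[OF M c(2)]] p
    by (auto simp: D_def)
  have "smooth_on D \<tau>"
    using M c unfolding D_def \<tau>_def smooth_manifold_def by fast
  then have \<tau>: "\<tau> differentiable (at (\<phi> p))"
    using smooth_on_differentiable D(2) by blast
  have \<tau>p: "\<tau> (\<phi> p) = \<psi> p"
    unfolding \<tau>_def by (rule chart_rep_apply[OF inj(1) p(1)])
  have "smooth_on (\<psi> ` V) ?F'"
    using \<Psi> c(2) by (auto simp: smooth_map_def)
  then have F': "?F' differentiable (at (\<tau> (\<phi> p)))"
    using smooth_on_differentiable p(2) \<tau>p by fastforce
  have F_eq: "?F z = ?F' (\<tau> z)" if z: "z \<in> D" for z
  proof -
    obtain u where u: "u \<in> U" "u \<in> V" "z = \<phi> u"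
      using z by (auto simp: D_def)
    then show ?thesis
      by (simp add: \<tau>_def chart_rep_apply[OF inj(1)] chart_rep_apply[OF inj(2)])
  qed
  have "pd i ?F (\<phi> p) = pd i (\<lambda>z. ?F' (\<tau> z)) (\<phi> p)" for i
    by (rule pd_cong_open[OF D F_eq])
  then have "pd i ?F (\<phi> p) = (\<Sum>j\<in>UNIV. (pd i \<tau> (\<phi> p) $ j) *\<^sub>R pd j ?F' (\<psi> p))" for i
    using pd_compose[OF \<tau> F', of i] frechet_derivative_eq_sum_pd[OF F', of "pd i \<tau> (\<phi> p)"]
    by (simp add: \<tau>p)
  then have "pd i ?F (\<phi> p) \<in> span (range (\<lambda>i. pd i ?F' (\<psi> p)))" for i
    by (simp only:) (intro span_sum span_scale span_base rangeI)
  then show ?thesis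
    by (intro span_minimal) auto
qed

section \<open>The pointwise identity\<close>

text \<open>\<open>grad_norm\<close> is evaluated in the chart chosen at \<open>p\<close>. Here any
  chart around \<open>p\<close> is allowed, so that a single chart can be used while
  \<open>p\<close> varies.\<close>

lemma grad_norm_sq:
  assumes M: "smooth_manifold T A" and \<Psi>: "spacelike_immersion T A S \<Psi>"
    and c: "(U, \<phi>) \<in> A" and p: "p \<in> U"
  shows "(grad_norm A \<Psi> (\<lambda>x. fst (\<Psi> x)) p)\<^sup>2 = time_grad_sq (\<lambda>i. pd i (chart_rep (U, \<phi>) \<Psi>) (\<phi> p))"
proof -
  obtain V \<psi> where c': "chart_at A p = (V, \<psi>)"
    by (cases "chart_at A p")
  have "p \<in> topspace T"
    using smooth_manifold_chartD(2)[OF M c] p by blast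
  then have V: "(V, \<psi>) \<in> A" "p \<in> V"
    using chart_at_mem[OF M] c' by force+
  let ?F = "chart_rep (V, \<psi>) \<Psi>"
  note F = spacelike_immersion_chartD[OF M \<Psi> V(1)]
  have y: "\<psi> p \<in> \<psi> ` V"
    using V(2) by blast
  have comp: "chart_rep (V, \<psi>) (\<lambda>x. fst (\<Psi> x)) = (\<lambda>z. fst (?F z))"
    by (auto simp: chart_rep_def)
  note sq = grad_norm_time_sq[OF smooth_on_differentiable[OF F(1) y] F(3)[OF y]]
  \<comment> \<open>Squaring undoes the \<open>sqrt\<close> in \<open>grad_norm\<close> because its
    argument is nonnegative; this is where the induced metric being Riemannian enters.\<close>
  have "time_grad_sq (\<lambda>i. pd i ?F (\<psi> p)) \<ge> 0"
    unfolding sq[symmetric] by (rule F(4)[OF y])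
  then have "(grad_norm A \<Psi> (\<lambda>x. fst (\<Psi> x)) p)\<^sup>2 = time_grad_sq (\<lambda>i. pd i ?F (\<psi> p))"
    by (simp add: grad_norm_def Let_def c' induced_metric_def comp sq)
  also have "\<dots> = time_grad_sq (\<lambda>i. pd i (chart_rep (U, \<phi>) \<Psi>) (\<phi> p))"
  proof -
    have sm: "smooth_map A \<Psi>"
      using \<Psi> by (simp add: spacelike_immersion_def)
    have "span (range (\<lambda>i. pd i ?F (\<psi> p))) = span (range (\<lambda>i. pd i (chart_rep (U, \<phi>) \<Psi>) (\<phi> p)))"
      using span_pd_transition[OF M c V(1) sm p V(2)] span_pd_transition[OF M V(1) c sm V(2) p] by blast
    then show ?thesis
      using tan_proj_cong_span[OF F(3)[OF y] spacelike_immersion_chartD(3)[OF M \<Psi> c imageI[OF p]]]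
      by (simp add: time_grad_sq_def)
  qed
  finally show ?thesis .
qed

text \<open>The identity behind both equivalences; it holds at every point of every spacelike
  immersion, stationary or not.\<close>

lemma mean_curvature_vector_Q:
  fixes \<Psi> :: "'m \<Rightarrow> 'd::finite lspace" and A :: "('m, 'k::finite) chart set"
  assumes J: "open J" and r: "admissible J r" and M: "smooth_manifold T A"
    and \<Psi>: "spacelike_immersion T A (Q J r) \<Psi>" and p: "p \<in> topspace T"
  shows "real CARD('k) *\<^sub>R mean_curvature_vector A (Q J r) \<Psi> p =
    laplacian_vec A \<Psi> \<Psi> p + q_fun r A \<Psi> p *\<^sub>R P_field r \<Psi> p"
proof -
  obtain U \<phi> where c: "chart_at A p = (U, \<phi>)"
    by (cases "chart_at A p")
  have U: "(U, \<phi>) \<in> A" "p \<in> U"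
    using chart_at_mem[OF M p] c by force+
  define Y where "Y = chart_rep (U, \<phi>) \<Psi>"
  define y where "y = \<phi> p"
  define D where "D = \<phi> ` U"
  define P where "P = P_vec r (\<Psi> p)"
  define e where "e i = pd i Y y" for i
  define B where "B = (\<Sum>i\<in>UNIV. \<Sum>j\<in>UNIV. matrix_inv (gmat e) $ i $ j *\<^sub>R pd i (pd j Y) y)"
  obtain V X where VX: "param_at (Q J r) (\<Psi> p) = (V, X)"
    by (cases "param_at (Q J r) (\<Psi> p)")
  note Y = spacelike_immersion_chartD[OF M \<Psi> U(1), folded Y_def D_def]
  have D: "open D" "y \<in> D"
    using smooth_manifold_chartD(3)[OF M U(1)] U(2) by (auto simp: D_def y_def)
  have Yy: "Y y = \<Psi> p"
    unfolding Y_def y_def by (rule chart_rep_apply[OF smooth_manifold_chartD(4)[OF M U(1)] U(2)])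
  have \<Psi>p: "\<Psi> p \<in> Q J r"
    using \<Psi> p by (auto simp: spacelike_immersion_def)
  have rs: "smooth_on J r"
    using r by (simp add: admissible_def)
  have PP: "lor P P > 0"
    unfolding P_def by (rule lor_P_vec_self_pos[OF r \<Psi>p])
  have inv: "invertible (gmat e)"
    using Y(3)[OF D(2)] by (simp add: e_def[abs_def])

  have X: "parametrization (Q J r) V X" "\<Psi> p \<in> X ` V"
    using parametrization_param_at[OF parametrization_Q_exists[OF J r \<Psi>p]] VX by simp_all
  have V: "open V" and Xs: "smooth_on V X" and XV: "X ` V \<subseteq> Q J r"
    using X(1) openin_subset[of "top_of_set (Q J r)"] by (auto simp: parametrization_def)
  define F where "F = inv_into V X \<circ> Y"
  obtain S where S: "open S" "y \<in> S" "S \<subseteq> D" "smooth_on S F" "F ` S \<subseteq> V"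
      "\<And>z. z \<in> S \<Longrightarrow> X (F z) = Y z"
    unfolding F_def
    by (rule parametrization_lift[OF X(1) D Y(1,2)]) (use X(2) Yy in auto)
  have Fy: "F y \<in> V"
    using S(2,5) by blast
  have "lor (pd a X (F y)) P = 0" for a
    using lor_pd_P_vec[OF rs V Fy Xs XV, of a] S(6)[OF S(2)] Yy by (simp add: P_def)
  then have "real CARD('k) *\<^sub>R frechet_derivative X (at (F y)) (mean_curv (pullback_metric lor_metric X) F y) =
      B - tan_proj e B - (lor B P / lor P P) *\<^sub>R P"
    using mean_curv_hypersurface[OF S(1,2) V S(5,4) Xs S(6) parametrization_inj_derivative[OF X(1) Fy], of P]
      PP inv by (simp add: e_def[abs_def] B_def)
  moreover have "mean_curvature_vector A (Q J r) \<Psi> p =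
      frechet_derivative X (at (F y)) (mean_curv (pullback_metric lor_metric X) F y)"
    by (simp add: mean_curvature_vector_def Let_def c VX F_def Y_def y_def)
  moreover have "laplacian_vec A \<Psi> \<Psi> p = B - tan_proj e B"
  proof -
    have lap: "laplacian A \<Psi> (\<lambda>x. L (\<Psi> x)) p = L (B - tan_proj e B)"
      if "bounded_linear L" for L :: "'d lspace \<Rightarrow> real"
    proof -
      have "chart_rep (U, \<phi>) (\<lambda>x. L (\<Psi> x)) = (\<lambda>z. L (Y z))"
        by (auto simp: chart_rep_def Y_def)
      then show ?thesis
        using divg_grad_pullback[OF D Y(1) Y(3) that]
        by (simp add: laplacian_def Let_def c induced_metric_def Y_def[symmetric] y_def[symmetric]
            ginv_pullback B_def e_def[abs_def])
    qed
    show ?thesis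
      using lap[OF bounded_linear_fst]
        lap[OF bounded_linear_compose[OF bounded_linear_vec_nth bounded_linear_snd]]
      by (simp add: laplacian_vec_def prod_eq_iff vec_eq_iff)
  qed
  \<comment> \<open>The bracket comes from the trace <B, P> and the denominator of q from <P, P>, so
    q is minus the coefficient of the component of \<open>B\<close> along P.\<close>
  moreover have "q_fun r A \<Psi> p = - (lor B P / lor P P)"
  proof -
    have "lor B P = - bracket r A \<Psi> p"
      using lor_trace_second_derivative_P_vec[OF J rs D Y(1,2) Y(3)[OF D(2)]] grad_norm_sq[OF M \<Psi> U]
      by (simp add: bracket_def Let_def P_def B_def e_def[abs_def] Yy) (simp add: Y_def y_def)
    then show ?thesis
      using lor_P_vec_self[OF \<Psi>p] by (simp add: q_fun_def Let_def P_def)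
  qed
  moreover have "P_field r \<Psi> p = P"
    by (simp add: P_def P_vec_def P_field_def)
  ultimately show ?thesis
    by simp
qed

lemma smooth_map_q_fun:
  fixes \<Psi> :: "'m \<Rightarrow> 'd::finite lspace" and A :: "('m, 'k::finite) chart set"
  assumes J: "open J" and r: "admissible J r" and M: "smooth_manifold T A"
    and \<Psi>: "spacelike_immersion T A (Q J r) \<Psi>"
  shows "smooth_map A (q_fun r A \<Psi>)"
  unfolding smooth_map_def
proof (clarify)
  fix U \<phi> assume c: "(U, \<phi>) \<in> A"
  define Y where "Y = chart_rep (U, \<phi>) \<Psi>"
  define D where "D = \<phi> ` U"
  note Y = spacelike_immersion_chartD[OF M \<Psi> c, folded Y_def D_def]
  have D: "open D"
    using smooth_manifold_chartD(3)[OF M c] by (simp add: D_def)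
  have rs: "smooth_on J r"
    using r by (simp add: admissible_def)
  define t where "t z = fst (Y z)" for z
  have tJ: "t z \<in> J" if "z \<in> D" for z
    using Y(2) that by (auto simp: t_def mem_Q_iff)
  have ts: "smooth_on D t"
    unfolding t_def by (rule smooth_on_bounded_linear_comp[OF D bounded_linear_fst Y(1)])
  have comp: "smooth_on D (\<lambda>z. f (t z))" if "smooth_on J f" for f :: "real \<Rightarrow> real"
    by (rule smooth_on_compose[OF D ts that]) (use tJ in auto)
  \<comment> \<open>The squared gradient norm of the time coordinate in the fixed chart, with
    entries that depend smoothly on \<open>z\<close>.\<close>
  define N where "N z = (\<Sum>i\<in>UNIV. \<Sum>j\<in>UNIV. ginv (pullback_metric lor_metric Y) z $ i $ j *
      (fst (pd i Y z) * fst (pd j Y z)))" for z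
  have N: "smooth_on D N"
    unfolding N_def
    by (intro smooth_on_sum smooth_on_mult D smooth_on_ginv_pullback Y(1,3)
        smooth_on_bounded_linear_comp[OF D bounded_linear_fst] smooth_on_pd)
  have eq: "chart_rep (U, \<phi>) (q_fun r A \<Psi>) z =
      (real CARD('k) - (deriv (deriv r) (t z) * r (t z) + (deriv r (t z))\<^sup>2 - 1) * N z) /
      ((r (t z))\<^sup>2 * (1 - (deriv r (t z))\<^sup>2))" if z: "z \<in> D" for z
  proof -
    obtain p where p: "p \<in> U" "z = \<phi> p"
      using z by (auto simp: D_def)
    note inj = smooth_manifold_chartD(4)[OF M c]
    have "fst (\<Psi> p) = t z"
      by (simp add: t_def Y_def p chart_rep_apply[OF inj p(1)])
    moreover have "(grad_norm A \<Psi> (\<lambda>x. fst (\<Psi> x)) p)\<^sup>2 = N z"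
      using grad_norm_sq[OF M \<Psi> c p(1)] time_grad_sq_eq[OF Y(3)[OF z]]
      by (simp add: N_def ginv_pullback) (simp add: p Y_def)
    ultimately show ?thesis
      by (simp add: p(2) chart_rep_apply[OF inj p(1)] q_fun_def bracket_def Let_def)
  qed
  have nz: "(r (t z))\<^sup>2 * (1 - (deriv r (t z))\<^sup>2) \<noteq> 0" if "z \<in> D" for z
    using admissible_factor_pos[OF r tJ[OF that]] r tJ[OF that] by (auto simp: admissible_def)
  have "smooth_on D (\<lambda>z. (real CARD('k) - (deriv (deriv r) (t z) * r (t z) + (deriv r (t z))\<^sup>2 - 1) * N z) /
      ((r (t z))\<^sup>2 * (1 - (deriv r (t z))\<^sup>2)))"
    by (intro smooth_on_divide smooth_on_diff smooth_on_add smooth_on_mult smooth_on_power2 smooth_on_const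
        D N comp rs smooth_on_deriv[OF J] nz)
  then show "smooth_on (\<phi> ` U) (chart_rep (U, \<phi>) (q_fun r A \<Psi>))"
    unfolding D_def[symmetric] by (subst smooth_on_cong[OF D eq])
qed

text \<open>The unit normal is P divided by its length, and \<open>alpha\<close> is minus the
  reciprocal of the same length, so together they produce -P / <P, P>.\<close>

lemma alpha_unit_normal_eq_q_P:
  assumes r: "admissible J r" and t: "fst (\<Psi> p) \<in> J"
  shows "(alpha r (fst (\<Psi> p)) * bracket r A \<Psi> p) *\<^sub>R unit_normal r (\<Psi> p) =
    - (q_fun r A \<Psi> p *\<^sub>R P_field r \<Psi> p)"
proof -
  define t where "t = fst (\<Psi> p)"
  define w where "w = 1 - (deriv r t)\<^sup>2"
  have pos: "r t > 0" "w > 0"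
    using admissible_factor_pos[OF r] r t by (auto simp: t_def w_def admissible_def)
  have "unit_normal r (\<Psi> p) = (1 / (r t * sqrt w)) *\<^sub>R P_field r \<Psi> p"
    by (simp add: unit_normal_def P_field_def t_def w_def split_beta mult.commute)
  moreover have "alpha r t * bracket r A \<Psi> p * (1 / (r t * sqrt w)) = - q_fun r A \<Psi> p"
  proof -
    have "alpha r t * bracket r A \<Psi> p * (1 / (r t * sqrt w)) = - (bracket r A \<Psi> p / (r t * sqrt w)\<^sup>2)"
      by (simp add: alpha_def w_def power2_eq_square)
    also have "(r t * sqrt w)\<^sup>2 = (r t)\<^sup>2 * w"
      using pos by (simp add: power_mult_distrib)
    finally show ?thesis
      by (simp add: q_fun_def Let_def t_def w_def)
  qed
  ultimately show ?thesis
    by (simp add: t_def)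
qed

theorem proposition4p1:
  fixes J :: "real set" and r :: "real \<Rightarrow> real" and n :: nat
    and T :: "'m topology" and A :: "('m, 'k::finite) chart set"
    and \<Psi> :: "'m \<Rightarrow> 'd::finite lspace"
  assumes dim: "CARD('d) = n + 1"
    and J: "open J" "is_interval J" "0 \<in> J"
    and r: "admissible J r"
    and M: "smooth_manifold T A"
    and \<Psi>: "spacelike_immersion T A (Q J r) \<Psi>"
  shows "(stationary_in T A (Q J r) \<Psi> \<longleftrightarrow>
           (\<forall>p\<in>topspace T. laplacian_vec A \<Psi> \<Psi> p =
              (alpha r (fst (\<Psi> p)) * bracket r A \<Psi> p) *\<^sub>R unit_normal r (\<Psi> p))) \<and>
         (stationary_in T A (Q J r) \<Psi> \<longleftrightarrow>
           (\<forall>p\<in>topspace T. laplacian_vec A \<Psi> \<Psi> p + q_fun r A \<Psi> p *\<^sub>R P_field r \<Psi> p = 0)) \<and>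
         smooth_map A (q_fun r A \<Psi>)"
proof -
  have J': "fst (\<Psi> p) \<in> J" if "p \<in> topspace T" for p
    using \<Psi> that by (auto simp: spacelike_immersion_def mem_Q_iff)
  \<comment> \<open>The factor \<open>real CARD('k)\<close> in the pointwise identity is nonzero, so
    it can be cancelled.\<close>
  have "mean_curvature_vector A (Q J r) \<Psi> p = 0 \<longleftrightarrow>
      laplacian_vec A \<Psi> \<Psi> p + q_fun r A \<Psi> p *\<^sub>R P_field r \<Psi> p = 0" if "p \<in> topspace T" for p
    unfolding mean_curvature_vector_Q[OF J(1) r M \<Psi> that, symmetric] by simp
  then have 1: "stationary_in T A (Q J r) \<Psi> \<longleftrightarrow>
      (\<forall>p\<in>topspace T. laplacian_vec A \<Psi> \<Psi> p + q_fun r A \<Psi> p *\<^sub>R P_field r \<Psi> p = 0)"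
    by (simp add: stationary_in_def)
  have "laplacian_vec A \<Psi> \<Psi> p = (alpha r (fst (\<Psi> p)) * bracket r A \<Psi> p) *\<^sub>R unit_normal r (\<Psi> p) \<longleftrightarrow>
      laplacian_vec A \<Psi> \<Psi> p + q_fun r A \<Psi> p *\<^sub>R P_field r \<Psi> p = 0" if "p \<in> topspace T" for p
    unfolding alpha_unit_normal_eq_q_P[where \<Psi> = \<Psi>, OF r J'[OF that]] eq_neg_iff_add_eq_0 ..
  with 1 show ?thesis
    using smooth_map_q_fun[OF J(1) r M \<Psi>] by simp
qed

end
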